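(* If $p\colon \mathbb{N} \to (1,\infty)$ is a fast-growing order function such that $\sum_{n=0}^\infty p(n)^{-1}$ is a recursive real, then there exists a convex sub-identical order function $g\colon\mathbb{N}\to[0,\infty)$ such that $\mathrm{LUA}(p) \leq_{\mathrm{s}} \mathrm{COMPLEX}(g)$ and $\mathrm{COMPLEX}(g) \neq \mathrm{MLR}$.
   Context: An order function is a computable (i.e. its values are uniformly computable reals), nondecreasing, unbounded function $\mathbb{N}\to\mathbb{R}$. A function $g\colon\mathbb{N}\to[0,\infty)$ is sub-identical if $\lim_{n\to\infty}(n-g(n))=\infty$; a nondecreasing $g$ is convex if $g(n+1)-g(n)\leq 1$ for all $n$. An order function $p\colon\mathbb{N}\to(1,\infty)$ is fast-growing if $\sum_{n=0}^\infty p(n)^{-1}<\infty$. A real is recursive if it is computable. Prefix-free complexity: a prefix-free machine is a partial recursive $M$ from $\{0,1\}^*$ to $\{0,1\}^*$ with prefix-free domain; $U$ is universal if for each prefix-free machine $M$ there is $\rho$ with $U(\rho^\frown\tau)\simeq M(\tau)$ for all $\tau$. Fix a universal $U$ and let $K(\sigma)=\min\{|\tau| : U(\tau)=\sigma\}$. For $f\colon\mathbb{N}\to\mathbb{R}$, $\mathrm{COMPLEX}(f)$ is the set of $X\in\{0,1\}^{\mathbb{N}}$ for which there is $c\in\mathbb{N}$ with $K(X\upharpoonright n)\geq f(n)-c$ for all $n$. $\mathrm{MLR}$ is the set of Martin-Löf random $X\in\{0,1\}^{\mathbb{N}}$, i.e. $\mathrm{MLR}=\mathrm{COMPLEX}(\lambda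 n.\,n)$. A partial recursive $\psi\colon\subseteq\mathbb{N}\to\mathbb{N}$ is linearly universal if for every partial recursive $\theta\colon\subseteq\mathbb{N}\to\mathbb{N}$ there are $a,b\in\mathbb{N}$ with $\psi(ax+b)\simeq\theta(x)$ for all $x$. For $p\colon\mathbb{N}\to(1,\infty)$, $\mathrm{LUA}(p)$ is the set of $X\in\mathbb{N}^{\mathbb{N}}$ such that $X(n)<p(n)$ for all $n$ and, for some linearly universal partial recursive $\psi$, there is no $n\in\operatorname{dom}\psi$ with $X(n)=\psi(n)$. For $P,Q\subseteq\mathbb{N}^{\mathbb{N}}$, $P\leq_{\mathrm{s}}Q$ means there is a partial recursive functional defined on all of $Q$ that maps $Q$ into $P$. *)

theory Defs
  imports Complex_Main "HOL-Library.Sublist"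
begin

section \<open>Partial recursive functions and functionals\<close>

text \<open>
  Kleene's schemes, together with a scheme for querying an oracle \<open>X\<close>. A program applied to
  the wrong number of arguments diverges, so no separate well-formedness condition is needed.
  In \<open>RPrec f g\<close> the recursion variable is the first argument; in \<open>RMin f\<close> the variable searched
  over is the first argument of \<open>f\<close>.
\<close>

datatype recf =
    RZero
  | RSucc
  | RProj nat
  | ROracle
  | RComp recf "recf list"
  | RPrec recf recf
  | RMin recf

fun recf_eval :: "(nat \<Rightarrow> nat) \<Rightarrow> recf \<Rightarrow> nat list \<Rightarrow> nat option" where
  "recf_eval X RZero xs = Some 0"
| "recf_eval X RSucc xs = (case xs of [x] \<Rightarrow> Some (Suc x) | _ \<Rightarrow> None)"
| "recf_eval X (RProj i) xs = (if i < length xs then Some (xs ! i) else None)"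
| "recf_eval X ROracle xs = (case xs of [x] \<Rightarrow> Some (X x) | _ \<Rightarrow> None)"
| "recf_eval X (RComp f gs) xs =
     (if \<forall>y \<in> set (map (\<lambda>g. recf_eval X g xs) gs). y \<noteq> None
      then recf_eval X f (map (\<lambda>g. the (recf_eval X g xs)) gs)
      else None)"
| "recf_eval X (RPrec f g) xs =
     (case xs of
        [] \<Rightarrow> None
      | n # ys \<Rightarrow>
          rec_nat (recf_eval X f ys)
            (\<lambda>m r. case r of None \<Rightarrow> None | Some v \<Rightarrow> recf_eval X g (m # v # ys)) n)"
| "recf_eval X (RMin f) xs =
     (if \<exists>y. recf_eval X f (y # xs) = Some 0 \<and> (\<forall>i<y. recf_eval X f (i # xs) \<noteq> None)
      then Some (LEAST y. recf_eval X f (y # xs) = Some 0)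
      else None)"

fun oracle_free :: "recf \<Rightarrow> bool" where
  "oracle_free RZero = True"
| "oracle_free RSucc = True"
| "oracle_free (RProj i) = True"
| "oracle_free ROracle = False"
| "oracle_free (RComp f gs) = (oracle_free f \<and> (\<forall>g \<in> set gs. oracle_free g))"
| "oracle_free (RPrec f g) = (oracle_free f \<and> oracle_free g)"
| "oracle_free (RMin f) = oracle_free f"

text \<open>The value of an oracle-free program does not depend on the oracle; we supply the zero one.\<close>

definition partial_recursive :: "(nat \<Rightarrow> nat option) \<Rightarrow> bool" where
  "partial_recursive \<theta> \<longleftrightarrow>
     (\<exists>e. oracle_free e \<and> (\<forall>x. recf_eval (\<lambda>_. 0) e [x] = \<theta> x))"

definition recursive1 :: "(nat \<Rightarrow> nat) \<Rightarrow> bool" where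
  "recursive1 h \<longleftrightarrow>
     (\<exists>e. oracle_free e \<and> (\<forall>x. recf_eval (\<lambda>_. 0) e [x] = Some (h x)))"

definition recursive2 :: "(nat \<Rightarrow> nat \<Rightarrow> nat) \<Rightarrow> bool" where
  "recursive2 h \<longleftrightarrow>
     (\<exists>e. oracle_free e \<and> (\<forall>x y. recf_eval (\<lambda>_. 0) e [x, y] = Some (h x y)))"

text \<open>
  \<open>P \<le>\<^sub>s Q\<close>: an oracle program \<open>e\<close> is the partial functional sending \<open>X\<close> to
  \<open>\<lambda>n. recf_eval X e [n]\<close>, defined at \<open>X\<close> iff this is total.
\<close>

definition strongly_reducible :: "(nat \<Rightarrow> nat) set \<Rightarrow> (nat \<Rightarrow> nat) set \<Rightarrow> bool" where
  "strongly_reducible P Q \<longleftrightarrow>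
     (\<exists>e. \<forall>X\<in>Q. \<exists>Y\<in>P. \<forall>n. recf_eval X e [n] = Some (Y n))"


section \<open>Computable reals and order functions\<close>

definition computable_real :: "real \<Rightarrow> bool" where
  "computable_real x \<longleftrightarrow>
     (\<exists>a b d. recursive1 a \<and> recursive1 b \<and> recursive1 d \<and>
        (\<forall>k. \<bar>x - (real (a k) - real (b k)) / (real (d k) + 1)\<bar> \<le> 1 / 2 ^ k))"

definition uniformly_computable :: "(nat \<Rightarrow> real) \<Rightarrow> bool" where
  "uniformly_computable f \<longleftrightarrow>
     (\<exists>a b d. recursive2 a \<and> recursive2 b \<and> recursive2 d \<and>
        (\<forall>n k. \<bar>f n - (real (a n k) - real (b n k)) / (real (d n k) + 1)\<bar> \<le> 1 / 2 ^ k))"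

definition order_function :: "(nat \<Rightarrow> real) \<Rightarrow> bool" where
  "order_function f \<longleftrightarrow> uniformly_computable f \<and> mono f \<and> \<not> bdd_above (range f)"

definition fast_growing :: "(nat \<Rightarrow> real) \<Rightarrow> bool" where
  "fast_growing p \<longleftrightarrow> order_function p \<and> (\<forall>n. 1 < p n) \<and> summable (\<lambda>n. inverse (p n))"

definition sub_identical :: "(nat \<Rightarrow> real) \<Rightarrow> bool" where
  "sub_identical g \<longleftrightarrow>
     (\<forall>n. 0 \<le> g n) \<and> filterlim (\<lambda>n. real n - g n) at_top sequentially"

definition convex_seq :: "(nat \<Rightarrow> real) \<Rightarrow> bool" where
  "convex_seq g \<longleftrightarrow> mono g \<and> (\<forall>n. g (n + 1) - g n \<le> 1)"


section \<open>Prefix-free complexity\<close>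

text \<open>Bijective base-2 numeration, least significant digit first.\<close>

primrec str_code :: "bool list \<Rightarrow> nat" where
  "str_code [] = 0"
| "str_code (b # bs) = (if b then 2 else 1) + 2 * str_code bs"

lemma bij_str_code: "bij str_code"
proof (rule bijI)
  show "inj str_code"
  proof (rule injI)
    fix xs ys show "str_code xs = str_code ys \<Longrightarrow> xs = ys"
    proof (induction xs arbitrary: ys)
      case Nil then show ?case by (cases ys) (auto split: if_splits)
    next
      case (Cons x xs)
      then obtain y zs where ys: "ys = y # zs" by (cases ys) (auto split: if_splits)
      have "x = y \<and> str_code xs = str_code zs"
        using Cons.prems ys by (cases x; cases y; simp; presburger)
      with Cons.IH ys show ?case by blast
    qed
  qed
  have "\<exists>xs. str_code xs = n" for n
  proof (induction n rule: less_induct)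
    case (less n)
    show ?case
    proof (cases "n = 0")
      case True then show ?thesis by (intro exI[of _ "[]"]) simp
    next
      case False
      then have "(n - 1) div 2 < n" by presburger
      then obtain xs where "str_code xs = (n - 1) div 2" using less by blast
      with False show ?thesis by (intro exI[of _ "even n # xs"]) (auto elim!: oddE evenE)
    qed
  qed
  then show "surj str_code" by (metis surjI)
qed

definition prefix_free_machine :: "(bool list \<Rightarrow> bool list option) \<Rightarrow> bool" where
  "prefix_free_machine M \<longleftrightarrow>
     (\<exists>\<theta>. partial_recursive \<theta> \<and> (\<forall>\<tau>. \<theta> (str_code \<tau>) = map_option str_code (M \<tau>))) \<and>
     (\<forall>\<sigma>\<in>dom M. \<forall>\<tau>\<in>dom M. prefix \<sigma> \<tau> \<longrightarrow> \<sigma> = \<tau>)"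

definition universal_machine :: "(bool list \<Rightarrow> bool list option) \<Rightarrow> bool" where
  "universal_machine U \<longleftrightarrow>
     prefix_free_machine U \<and>
     (\<forall>M. prefix_free_machine M \<longrightarrow> (\<exists>\<rho>. \<forall>\<tau>. U (\<rho> @ \<tau>) = M \<tau>))"

definition prefix_complexity :: "(bool list \<Rightarrow> bool list option) \<Rightarrow> bool list \<Rightarrow> nat" where
  "prefix_complexity U \<sigma> = (LEAST k. \<exists>\<tau>. length \<tau> = k \<and> U \<tau> = Some \<sigma>)"

text \<open>Cantor space is taken as the set of 0-1-valued functions in Baire space.\<close>

definition initial_segment :: "(nat \<Rightarrow> nat) \<Rightarrow> nat \<Rightarrow> bool list" where
  "initial_segment X n = map (\<lambda>i. X i = 1) [0..<n]"

definition COMPLEX :: "(bool list \<Rightarrow> bool list option) \<Rightarrow> (nat \<Rightarrow> real) \<Rightarrow> (nat \<Rightarrow> nat) set" where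
  "COMPLEX U f =
     {X. (\<forall>n. X n \<in> {0, 1}) \<and>
         (\<exists>c::nat. \<forall>n. real (prefix_complexity U (initial_segment X n)) \<ge> f n - real c)}"

definition MLR :: "(bool list \<Rightarrow> bool list option) \<Rightarrow> (nat \<Rightarrow> nat) set" where
  "MLR U = COMPLEX U (\<lambda>n. real n)"


section \<open>Linearly universal avoidance\<close>

definition linearly_universal :: "(nat \<Rightarrow> nat option) \<Rightarrow> bool" where
  "linearly_universal \<psi> \<longleftrightarrow>
     partial_recursive \<psi> \<and>
     (\<forall>\<theta>. partial_recursive \<theta> \<longrightarrow> (\<exists>a b. \<forall>x. \<psi> (a * x + b) = \<theta> x))"

definition LUA :: "(nat \<Rightarrow> real) \<Rightarrow> (nat \<Rightarrow> nat) set" where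
  "LUA p =
     {X. (\<forall>n. real (X n) < p n) \<and>
         (\<exists>\<psi>. linearly_universal \<psi> \<and> \<not> (\<exists>n\<in>dom \<psi>. \<psi> n = Some (X n)))}"

end

(*
  Let \<open>2 ^ M n\<close> be a power of two below \<open>p n\<close>, up to a bounded factor, and let \<open>Y n\<close> be the number
  coded by the first \<open>M n\<close> bits of \<open>X\<close>. Since the sum of \<open>1 / p n\<close> is computable, its tails can be
  bounded effectively, so there is a recursive, unbounded, slowly growing \<open>q\<close> for which the sum of
  \<open>2 ^ (q (M n) - M n)\<close> still converges; by Kraft's inequality \<open>n\<close> then has a prefix-free code of
  length \<open>M n - q (M n) + O(1)\<close>. If \<open>\<psi> n = Y n\<close>, this code describes the first \<open>M n\<close> bits of \<open>X\<close>,
  which is impossible for large \<open>n\<close> when \<open>X\<close> is complex for \<open>g m = m - q m div 2\<close>. The finitely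
  many remaining \<open>n\<close> are deleted from the domain of \<open>\<psi>\<close>.

  A sequence that is zero wherever \<open>q div 2\<close> jumps, and as complex as possible elsewhere, lies in
  COMPLEX(g) but is not random.
*)
theory Submission
  imports Defs "HOL-Analysis.Infinite_Sum"
begin

section \<open>Closure properties of the recursive functions\<close>

text \<open>The gain \<open>q\<close> has to serve two ends at once. Sub-identity asks that
  \<open>m - g m\<close> be unbounded, while avoidance asks that \<open>g (M n)\<close> exceed the
  code length of \<open>n\<close> by an unbounded amount, because the constant in
  \<open>COMPLEX\<close> depends on \<open>X\<close>. Subtracting only half of \<open>q\<close>
  leaves an unbounded share for each. The gain is a function of the length \<open>M n\<close> rather
  than of \<open>n\<close>, since \<open>g\<close> sees only the length of a string. Convergence
  alone would yield some such gain, but \<open>q\<close> must be recursive, both for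
  \<open>g\<close> to be an order function and for the codes to be decoded by a machine; this is
  where computability of the sum enters. Tails are driven below \<open>8 * (1 / 4) ^ j\<close> from
  length \<open>t j\<close> on, and \<open>q m\<close> counts the \<open>j\<close> with
  \<open>t j \<le> m\<close>: the factor \<open>2 ^ q\<close> then contributes about
  \<open>2 ^ j\<close> against \<open>4 ^ j\<close>. \<open>M\<close> is made nondecreasing, and so
  are the resulting code lengths; code words can then be assigned from left to right with no
  bookkeeping of free space.\<close>

definition computable :: "nat \<Rightarrow> (nat list \<Rightarrow> nat) \<Rightarrow> bool" where
  "computable k F \<longleftrightarrow>
     (\<exists>e. oracle_free e \<and> (\<forall>X xs. length xs = k \<longrightarrow> recf_eval X e xs = Some (F xs)))"

definition decidable :: "nat \<Rightarrow> (nat list \<Rightarrow> bool) \<Rightarrow> bool" where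
  "decidable k P \<longleftrightarrow> computable k (\<lambda>xs. of_bool (P xs))"

text \<open>Programs known to be correct for the zero oracle can thus be called inside oracle
  programs, and \<open>computable\<close> may quantify over all oracles.\<close>

lemma oracle_free_eval:
  "oracle_free e \<Longrightarrow> recf_eval X e xs = recf_eval Y e xs"
proof (induction e arbitrary: xs)
  case (RComp f gs)
  have "map (\<lambda>g. recf_eval X g xs) gs = map (\<lambda>g. recf_eval Y g xs) gs"
    and "map (\<lambda>g. the (recf_eval X g xs)) gs = map (\<lambda>g. the (recf_eval Y g xs)) gs"
    using RComp by auto
  moreover have "recf_eval X f zs = recf_eval Y f zs" for zs using RComp by simp
  ultimately show ?case by (simp only: recf_eval.simps)
next
  case (RPrec f g)
  have "recf_eval X f = recf_eval Y f" "recf_eval X g = recf_eval Y g"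
    using RPrec by auto
  then show ?case by (simp only: recf_eval.simps)
next
  case (RMin f)
  have "recf_eval X f = recf_eval Y f" using RMin by auto
  then show ?case by simp
qed auto

lemma computableI:
  assumes "oracle_free e" "\<And>X xs. length xs = k \<Longrightarrow> recf_eval X e xs = Some (F xs)"
  shows "computable k F"
  using assms unfolding computable_def by blast

lemma computableE:
  assumes "computable k F"
  obtains e where "oracle_free e" "\<And>X xs. length xs = k \<Longrightarrow> recf_eval X e xs = Some (F xs)"
  using assms unfolding computable_def by blast

lemma computable_cong:
  assumes "computable k F" "\<And>xs. length xs = k \<Longrightarrow> F xs = G xs"
  shows "computable k G"
  using assms unfolding computable_def by metis

lemma recursive1_iff: "recursive1 h \<longleftrightarrow> computable 1 (\<lambda>xs. h (xs ! 0))"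
proof
  assume "recursive1 h"
  then obtain e where "oracle_free e" "\<And>x. recf_eval (\<lambda>_. 0) e [x] = Some (h x)"
    unfolding recursive1_def by blast
  moreover from this have "recf_eval X e [x] = Some (h x)" for X x
    using oracle_free_eval[of e X "[x]" "\<lambda>_. 0"] by simp
  ultimately show "computable 1 (\<lambda>xs. h (xs ! 0))"
    by (intro computableI[of e]) (auto simp: length_Suc_conv)
next
  assume "computable 1 (\<lambda>xs. h (xs ! 0))"
  then show "recursive1 h" unfolding recursive1_def computable_def
    by (metis One_nat_def length_Cons list.size(3) nth_Cons_0)
qed

lemma recursive2_iff: "recursive2 h \<longleftrightarrow> computable 2 (\<lambda>xs. h (xs ! 0) (xs ! 1))"
proof
  assume "recursive2 h"
  then obtain e where "oracle_free e" "\<And>x y. recf_eval (\<lambda>_. 0) e [x, y] = Some (h x y)"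
    unfolding recursive2_def by blast
  moreover from this have "recf_eval X e [x, y] = Some (h x y)" for X x y
    using oracle_free_eval[of e X "[x, y]" "\<lambda>_. 0"] by simp
  ultimately show "computable 2 (\<lambda>xs. h (xs ! 0) (xs ! 1))"
    by (intro computableI[of e]) (auto simp: length_Suc_conv numeral_2_eq_2)
next
  assume "computable 2 (\<lambda>xs. h (xs ! 0) (xs ! 1))"
  then obtain e where "oracle_free e"
    "\<And>X xs. length xs = 2 \<Longrightarrow> recf_eval X e xs = Some (h (xs ! 0) (xs ! 1))"
    unfolding computable_def by blast
  then show "recursive2 h" unfolding recursive2_def by (intro exI[of _ e]) simp
qed

lemma recf_eval_RComp:
  assumes "\<And>g. g \<in> set gs \<Longrightarrow> recf_eval X g xs = Some (h g)"
  shows "recf_eval X (RComp f gs) xs = recf_eval X f (map h gs)"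
proof -
  have "map (\<lambda>g. the (recf_eval X g xs)) gs = map h gs" using assms by simp
  moreover have "\<forall>y \<in> set (map (\<lambda>g. recf_eval X g xs) gs). y \<noteq> None" using assms by simp
  ultimately show ?thesis by (metis recf_eval.simps(5))
qed

lemma computable_nth: "i < k \<Longrightarrow> computable k (\<lambda>xs. xs ! i)"
  by (rule computableI[of "RProj i"]) auto

text \<open>Recursion, summation and search put their new variables in front of the argument list,
  so their bodies reach the arguments through \<open>hd\<close> and \<open>tl\<close>; these forms
  let \<open>intro\<close> resolve such bodies.\<close>

lemma computable_hd: "0 < k \<Longrightarrow> computable k (\<lambda>xs. hd xs)"
  by (rule computable_cong[OF computable_nth[of 0]]) (auto simp: hd_conv_nth)

lemma computable_tl_nth: "Suc i < k \<Longrightarrow> computable k (\<lambda>xs. tl xs ! i)"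
  by (rule computable_cong[OF computable_nth[of "Suc i"]]) (auto simp: nth_tl)

lemma computable_hd_tl: "1 < k \<Longrightarrow> computable k (\<lambda>xs. hd (tl xs))"
  by (rule computable_cong[OF computable_nth[of 1]]) (auto simp: hd_conv_nth nth_tl tl_def split: list.split)

lemma computable_tl_tl_nth: "Suc (Suc i) < k \<Longrightarrow> computable k (\<lambda>xs. tl (tl xs) ! i)"
  by (rule computable_cong[OF computable_nth[of "Suc (Suc i)"]]) (auto simp: nth_tl)

lemma computable_const: "computable k (\<lambda>xs. c)"
proof (induction c)
  case 0
  then show ?case by (intro computableI[of RZero]) auto
next
  case (Suc c)
  then obtain e where "oracle_free e" "\<And>X xs. length xs = k \<Longrightarrow> recf_eval X e xs = Some c"
    by (elim computableE) blast
  then show ?case by (intro computableI[of "RComp RSucc [e]"]) auto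
qed

lemma computable_comp:
  assumes "computable (length Gs) F" "\<And>G. G \<in> set Gs \<Longrightarrow> computable k G"
  shows "computable k (\<lambda>xs. F (map (\<lambda>G. G xs) Gs))"
proof -
  obtain e where e: "oracle_free e"
    "\<And>X xs. length xs = length Gs \<Longrightarrow> recf_eval X e xs = Some (F xs)"
    using assms(1) by (elim computableE) blast
  obtain p where p: "\<And>G. G \<in> set Gs \<Longrightarrow> oracle_free (p G)"
    "\<And>G X xs. G \<in> set Gs \<Longrightarrow> length xs = k \<Longrightarrow> recf_eval X (p G) xs = Some (G xs)"
    using assms(2) unfolding computable_def by metis
  show ?thesis
  proof (rule computableI[of "RComp e (map p Gs)"])
    show "oracle_free (RComp e (map p Gs))" using e p by auto
    fix X and xs :: "nat list" assume l: "length xs = k"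
    have "recf_eval X (RComp e (map p Gs)) xs =
        recf_eval X e (map (\<lambda>q. the (recf_eval X q xs)) (map p Gs))"
      by (rule recf_eval_RComp) (use p l in auto)
    also have "map (\<lambda>q. the (recf_eval X q xs)) (map p Gs) = map (\<lambda>G. G xs) Gs"
      using p l by simp
    finally show "recf_eval X (RComp e (map p Gs)) xs = Some (F (map (\<lambda>G. G xs) Gs))"
      using e by simp
  qed
qed

lemma computable_comp1:
  assumes "computable 1 (\<lambda>xs. f (xs ! 0))" "computable k F"
  shows "computable k (\<lambda>xs. f (F xs))"
proof -
  have "computable k (\<lambda>xs. (\<lambda>xs. f (xs ! 0)) (map (\<lambda>G. G xs) [F]))"
    by (rule computable_comp) (use assms in auto)
  then show ?thesis by simp
qed

lemma computable_comp2:
  assumes "computable 2 (\<lambda>xs. f (xs ! 0) (xs ! 1))" "computable k F" "computable k G"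
  shows "computable k (\<lambda>xs. f (F xs) (G xs))"
proof -
  have "computable k (\<lambda>xs. (\<lambda>xs. f (xs ! 0) (xs ! 1)) (map (\<lambda>G. G xs) [F, G]))"
    by (rule computable_comp) (use assms in \<open>auto simp: numeral_2_eq_2\<close>)
  then show ?thesis by simp
qed

lemma computable_recursive1:
  "recursive1 f \<Longrightarrow> computable k F \<Longrightarrow> computable k (\<lambda>xs. f (F xs))"
  unfolding recursive1_iff by (rule computable_comp1)

lemma computable_recursive2:
  "recursive2 f \<Longrightarrow> computable k F \<Longrightarrow> computable k G \<Longrightarrow>
     computable k (\<lambda>xs. f (F xs) (G xs))"
  unfolding recursive2_iff by (rule computable_comp2)

lemma computable_rec:
  assumes "computable k A" "computable (Suc (Suc k)) (\<lambda>ys. G (hd ys) (hd (tl ys)) (tl (tl ys)))"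
    "computable k N"
  shows "computable k (\<lambda>xs. rec_nat (A xs) (\<lambda>m r. G m r xs) (N xs))"
proof -
  obtain a where a: "oracle_free a"
    "\<And>X xs. length xs = k \<Longrightarrow> recf_eval X a xs = Some (A xs)"
    using assms(1) unfolding computable_def by blast
  obtain g where g: "oracle_free g"
    "\<And>X ys. length ys = Suc (Suc k) \<Longrightarrow>
       recf_eval X g ys = Some (G (hd ys) (hd (tl ys)) (tl (tl ys)))"
    using assms(2) unfolding computable_def by blast
  have g': "recf_eval X g (m # r # xs) = Some (G m r xs)" if "length xs = k" for X m r xs
    using g(2)[of "m # r # xs"] that by simp
  obtain n where n: "oracle_free n"
    "\<And>X xs. length xs = k \<Longrightarrow> recf_eval X n xs = Some (N xs)"
    using assms(3) unfolding computable_def by blast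
  show ?thesis
  proof (rule computableI[of "RComp (RPrec a g) (n # map RProj [0..<k])"])
    show "oracle_free (RComp (RPrec a g) (n # map RProj [0..<k]))" using a g n by auto
    fix X and xs :: "nat list" assume l: "length xs = k"
    have r: "recf_eval X (RPrec a g) (j # xs) = Some (rec_nat (A xs) (\<lambda>m r. G m r xs) j)" for j
      by (induction j) (use a g' l in simp_all)
    have "recf_eval X (RComp (RPrec a g) (n # map RProj [0..<k])) xs =
        recf_eval X (RPrec a g) (map (\<lambda>q. the (recf_eval X q xs)) (n # map RProj [0..<k]))"
      by (rule recf_eval_RComp) (use n l in auto)
    also have "map (\<lambda>q. the (recf_eval X q xs)) (n # map RProj [0..<k]) = N xs # xs"
      using n l by (auto intro: nth_equalityI)
    finally show "recf_eval X (RComp (RPrec a g) (n # map RProj [0..<k])) xs =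
        Some (rec_nat (A xs) (\<lambda>m r. G m r xs) (N xs))"
      using r by simp
  qed
qed

section \<open>Arithmetic on computable functions\<close>

lemma computable_Suc: "computable k F \<Longrightarrow> computable k (\<lambda>xs. Suc (F xs))"
  by (rule computable_comp1[where f = Suc], rule computableI[of RSucc])
    (auto simp: length_Suc_conv)

lemma computable_pred: 
  assumes "computable k F" shows "computable k (\<lambda>xs. F xs - 1)"
proof -
  have "computable k (\<lambda>xs. rec_nat 0 (\<lambda>m r. m) (F xs))"
    by (intro computable_rec computable_const computable_hd assms) auto
  moreover have "rec_nat 0 (\<lambda>m r. m) n = n - 1" for n :: nat by (cases n) auto
  ultimately show ?thesis by simp
qed

lemma computable_add:
  assumes "computable k F" "computable k G" shows "computable k (\<lambda>xs. F xs + G xs)"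
proof -
  have "computable k (\<lambda>xs. rec_nat (F xs) (\<lambda>m r. Suc r) (G xs))"
    by (intro computable_rec computable_Suc computable_hd_tl assms) auto
  moreover have "rec_nat a (\<lambda>m r. Suc r) b = a + b" for a b :: nat by (induction b) auto
  ultimately show ?thesis by simp
qed

lemma computable_diff:
  assumes "computable k F" "computable k G" shows "computable k (\<lambda>xs. F xs - G xs)"
proof -
  have "computable k (\<lambda>xs. rec_nat (F xs) (\<lambda>m r. r - 1) (G xs))"
    by (intro computable_rec computable_pred computable_hd_tl assms) auto
  moreover have "rec_nat a (\<lambda>m r. r - 1) b = a - b" for a b :: nat by (induction b) auto
  ultimately show ?thesis by simp
qed

lemma computable_sum:
  assumes "computable (Suc k) (\<lambda>ys. F (hd ys) (tl ys))" "computable k B"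
  shows "computable k (\<lambda>xs. \<Sum>i<B xs. F i xs)"
proof -
  \<comment> \<open>A recursion step receives counter, accumulator and parameters; the summand has
    to be made blind to the accumulator.\<close>
  have "computable (Suc (Suc k)) (\<lambda>ys. (\<lambda>zs. F (hd zs) (tl zs))
     (map (\<lambda>G. G ys) ((\<lambda>ys. hd ys) # map (\<lambda>i ys. tl (tl ys) ! i) [0..<k])))"
    by (rule computable_comp) (use assms in \<open>auto intro!: computable_hd computable_tl_tl_nth\<close>)
  then have "computable (Suc (Suc k)) (\<lambda>ys. F (hd ys) (tl (tl ys)))"
    by (rule computable_cong) (simp add: comp_def, rule arg_cong[where f = "F _"], rule nth_equalityI, auto)
  then have "computable k (\<lambda>xs. rec_nat 0 (\<lambda>m r. r + F m xs) (B xs))"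
    by (intro computable_rec computable_add computable_hd_tl computable_const assms(2)) auto
  moreover have "rec_nat 0 (\<lambda>m r. r + F m xs) b = (\<Sum>i<b. F i xs)" for b xs
    by (induction b) auto
  ultimately show ?thesis by simp
qed

lemma computable_mult:
  assumes "computable k F" "computable k G" shows "computable k (\<lambda>xs. F xs * G xs)"
proof -
  have "computable 2 (\<lambda>xs. \<Sum>i<xs ! 1. xs ! 0)"
    by (intro computable_sum computable_tl_nth computable_nth) auto
  then have "computable 2 (\<lambda>xs. xs ! 0 * xs ! 1)" by (simp add: mult.commute)
  then show ?thesis by (rule computable_comp2) (use assms in auto)
qed

lemma computable_power:
  assumes "computable k F" "computable k G" shows "computable k (\<lambda>xs. F xs ^ G xs)"
proof -
  have "computable 2 (\<lambda>xs. rec_nat 1 (\<lambda>m r. xs ! 0 * r) (xs ! 1))"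
    by (intro computable_rec computable_mult computable_hd_tl computable_const computable_nth
        computable_tl_tl_nth) auto
  moreover have "rec_nat 1 (\<lambda>m r. a * r) b = a ^ b" for a b :: nat by (induction b) auto
  ultimately have "computable 2 (\<lambda>xs. xs ! 0 ^ xs ! 1)" by simp
  then show ?thesis by (rule computable_comp2) (use assms in auto)
qed

section \<open>Decidable predicates, division and search\<close>

lemma computable_of_bool: "decidable k P \<Longrightarrow> computable k (\<lambda>xs. of_bool (P xs))"
  by (simp add: decidable_def)

lemma decidable_not: "decidable k P \<Longrightarrow> decidable k (\<lambda>xs. \<not> P xs)"
  unfolding decidable_def of_bool_not_iff
  by (rule computable_cong[OF computable_diff[OF computable_const[of _ 1]]]) auto

lemma decidable_conj: "decidable k P \<Longrightarrow> decidable k Q \<Longrightarrow> decidable k (\<lambda>xs. P xs \<and> Q xs)"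
  unfolding decidable_def of_bool_conj by (rule computable_mult)

lemma decidable_disj: "decidable k P \<Longrightarrow> decidable k Q \<Longrightarrow> decidable k (\<lambda>xs. P xs \<or> Q xs)"
  using decidable_not[OF decidable_conj[OF decidable_not decidable_not], of k P Q] by simp

lemma decidable_le:
  assumes "computable k F" "computable k G" shows "decidable k (\<lambda>xs. F xs \<le> G xs)"
proof -
  have "computable k (\<lambda>xs. 1 - (F xs - G xs))"
    by (intro computable_diff computable_const assms)
  then show ?thesis unfolding decidable_def by (rule computable_cong) auto
qed

lemma decidable_less:
  assumes "computable k F" "computable k G" shows "decidable k (\<lambda>xs. F xs < G xs)"
  using decidable_le[OF computable_Suc[OF assms(1)] assms(2)] by (simp add: Suc_le_eq)

lemma decidable_eq:
  assumes "computable k F" "computable k G" shows "decidable k (\<lambda>xs. F xs = G xs)"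
  using decidable_conj[OF decidable_le[OF assms] decidable_le[OF assms(2,1)]]
  by (simp only: order.eq_iff[symmetric])

lemma computable_if:
  assumes "decidable k P" "computable k F" "computable k G"
  shows "computable k (\<lambda>xs. if P xs then F xs else G xs)"
proof -
  have "computable k (\<lambda>xs. of_bool (P xs) * F xs + of_bool (\<not> P xs) * G xs)"
    by (intro computable_add computable_mult computable_of_bool decidable_not assms)
  then show ?thesis by (rule computable_cong) auto
qed

text \<open>Reduces division to bounded counting: the quotient is the number of positive multiples
  of \<open>y\<close> up to \<open>x\<close>. The conjunct \<open>0 < y\<close> makes the count
  agree with \<open>x div 0 = 0\<close>.\<close>

lemma div_as_sum: "(x::nat) div y = (\<Sum>i<x. of_bool (Suc i * y \<le> x \<and> 0 < y))"
proof (cases "y = 0")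
  case False
  have "(\<Sum>i<x. of_bool (Suc i * y \<le> x \<and> 0 < y)) = card ({..<x} \<inter> {i. Suc i * y \<le> x \<and> 0 < y})"
    by (simp del: mult_Suc)
  also have "{..<x} \<inter> {i. Suc i * y \<le> x \<and> 0 < y} = {..<x div y}"
  proof -
    have "Suc i * y \<le> x \<longleftrightarrow> i < x div y" for i
      using False less_eq_div_iff_mult_less_eq[of y "Suc i" x] Suc_le_eq by blast
    moreover have "i < x" if "i < x div y" for i
      using that div_le_dividend[of x y] by linarith
    ultimately show ?thesis using False by blast
  qed
  finally show ?thesis by simp
qed simp

lemma computable_div:
  assumes "computable k F" "computable k G" shows "computable k (\<lambda>xs. F xs div G xs)"
proof -
  have "computable 2 (\<lambda>xs. \<Sum>i<xs ! 0. of_bool (Suc i * xs ! 1 \<le> xs ! 0 \<and> 0 < xs ! 1))"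
    by (intro computable_sum computable_of_bool decidable_conj decidable_le decidable_less
      computable_mult computable_Suc computable_hd computable_tl_nth computable_nth computable_const)
      auto
  then have "computable 2 (\<lambda>xs. xs ! 0 div xs ! 1)" unfolding div_as_sum .
  then show ?thesis by (rule computable_comp2) (use assms in auto)
qed

lemma decidable_odd:
  assumes "computable k F" shows "decidable k (\<lambda>xs. odd (F xs))"
proof -
  have "computable k (\<lambda>xs. F xs - 2 * (F xs div 2))"
    by (intro computable_diff computable_mult computable_div computable_const assms)
  then show ?thesis unfolding decidable_def
    by (rule computable_cong) (auto elim!: oddE evenE)
qed

lemma computable_Least:
  assumes "decidable (Suc k) (\<lambda>ys. P (hd ys) (tl ys))" "\<And>xs. length xs = k \<Longrightarrow> \<exists>i. P i xs"
  shows "computable k (\<lambda>xs. LEAST i. P i xs)"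
proof -
  \<comment> \<open>\<open>RMin\<close> looks for a zero, hence the indicator of the
    negation.\<close>
  have "computable (Suc k) (\<lambda>ys. of_bool (\<not> P (hd ys) (tl ys)))"
    by (intro computable_of_bool decidable_not assms)
  then obtain e where e: "oracle_free e"
    "\<And>X y xs. length xs = k \<Longrightarrow> recf_eval X e (y # xs) = Some (of_bool (\<not> P y xs))"
  proof (rule computableE)
    fix e assume "oracle_free e" and "\<And>X ys. length ys = Suc k \<Longrightarrow>
      recf_eval X e ys = Some (of_bool (\<not> P (hd ys) (tl ys)))"
    then show thesis by (intro that[of e]) auto
  qed
  show ?thesis
  proof (rule computableI[of "RMin e"])
    fix X and xs :: "nat list" assume l: "length xs = k"
    then show "recf_eval X (RMin e) xs = Some (LEAST i. P i xs)"
      using e assms(2)[OF l] by (simp add: of_bool_def)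
  qed (use e in simp)
qed

lemma recursive1I: "computable 1 (\<lambda>xs. h (xs ! 0)) \<Longrightarrow> recursive1 h"
  by (simp add: recursive1_iff)

lemma recursive2I: "computable 2 (\<lambda>xs. h (xs ! 0) (xs ! 1)) \<Longrightarrow> recursive2 h"
  by (simp add: recursive2_iff)

lemmas computable_intros =
  computable_const computable_nth computable_hd computable_tl_nth computable_hd_tl
  computable_tl_tl_nth computable_Suc computable_add computable_diff computable_mult
  computable_power computable_div computable_sum computable_of_bool computable_if
  decidable_not decidable_conj decidable_disj decidable_le decidable_less decidable_eq decidable_odd

subsection \<open>Partial recursive functions\<close>

lemma partial_recursiveE:
  assumes "partial_recursive \<theta>"
  obtains e where "oracle_free e" "\<And>X x. recf_eval X e [x] = \<theta> x"
  using assms oracle_free_eval unfolding partial_recursive_def by metis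

lemma partial_recursiveI:
  assumes "oracle_free e" "\<And>x. recf_eval (\<lambda>_. 0) e [x] = \<theta> x"
  shows "partial_recursive \<theta>"
  using assms unfolding partial_recursive_def by blast

lemma recursive1E:
  assumes "recursive1 h"
  obtains e where "oracle_free e" "\<And>X x. recf_eval X e [x] = Some (h x)"
  using assms oracle_free_eval unfolding recursive1_def by metis

lemma recursive2E:
  assumes "recursive2 h"
  obtains e where "oracle_free e" "\<And>X x y. recf_eval X e [x, y] = Some (h x y)"
  using assms oracle_free_eval unfolding recursive2_def by metis

lemma partial_recursive_total: "recursive1 h \<Longrightarrow> partial_recursive (\<lambda>x. Some (h x))"
  by (elim recursive1E) (rule partial_recursiveI, auto)

lemma partial_recursive_comp:
  assumes "partial_recursive \<theta>" "recursive1 h"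
  shows "partial_recursive (\<lambda>x. \<theta> (h x))"
proof -
  obtain e f where "oracle_free e" "\<And>X x. recf_eval X e [x] = \<theta> x"
    "oracle_free f" "\<And>X x. recf_eval X f [x] = Some (h x)"
    using assms by (elim partial_recursiveE recursive1E) blast
  then show ?thesis by (intro partial_recursiveI[of "RComp e [f]"]) auto
qed

lemma partial_recursive_map_option:
  assumes "recursive2 h" "partial_recursive \<theta>"
  shows "partial_recursive (\<lambda>x. map_option (h x) (\<theta> x))"
proof -
  obtain e f where "oracle_free e" "\<And>X x. recf_eval X e [x] = \<theta> x"
    "oracle_free f" "\<And>X x y. recf_eval X f [x, y] = Some (h x y)"
    using assms by (elim partial_recursiveE recursive2E) blast
  then show ?thesis
    by (intro partial_recursiveI[of "RComp f [RProj 0, e]"]) (auto simp: map_option_case split: option.split)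
qed

text \<open>Looks up an input \<open>z\<close> in the enumeration \<open>c\<close>; the unbounded
  search diverges when \<open>z\<close> is not listed, which is the right behaviour for a machine
  whose domain is contained in the set of listed codes.\<close>

lemma partial_recursive_search:
  assumes "recursive1 c" "partial_recursive \<theta>"
  shows "partial_recursive (\<lambda>z. if \<exists>n. c n = z then \<theta> (LEAST n. c n = z) else None)"
proof -
  have "computable 2 (\<lambda>ys. of_bool (c (ys ! 0) \<noteq> ys ! 1))"
    by (intro computable_intros computable_recursive1[OF assms(1)]) auto
  then have "recursive2 (\<lambda>n z. of_bool (c n \<noteq> z))" by (rule recursive2I)
  then obtain e f where "oracle_free e" "\<And>X x. recf_eval X e [x] = \<theta> x"
    "oracle_free f" "\<And>X n z. recf_eval X f [n, z] = Some (of_bool (c n \<noteq> z))"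
    using assms(2) by (elim partial_recursiveE recursive2E) blast
  then show ?thesis
    by (intro partial_recursiveI[of "RComp e [RMin f]"]) auto
qed

lemma partial_recursive_restrict:
  assumes "partial_recursive \<theta>"
  shows "partial_recursive (\<lambda>x. if x < N then None else \<theta> x)"
proof -
  have "computable 2 (\<lambda>ys. of_bool (ys ! 1 < N))" by (intro computable_intros) auto
  then have "recursive2 (\<lambda>n x. of_bool (x < N))" by (rule recursive2I)
  then obtain e f where "oracle_free e" "\<And>X x. recf_eval X e [x] = \<theta> x"
    "oracle_free f" "\<And>X n x. recf_eval X f [n, x] = Some (of_bool (x < N))"
    using assms by (elim partial_recursiveE recursive2E) blast
  \<comment> \<open>The predicate does not depend on the searched variable, so the search halts at
    once if \<open>x \<ge> N\<close> and diverges otherwise; the projection then discards its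
    result.\<close>
  then show ?thesis
    by (intro partial_recursiveI[of "RComp (RProj 1) [RMin f, e]"]) auto
qed

section \<open>Codes of bit strings\<close>

lemma str_code_eq_iff: "str_code xs = str_code ys \<longleftrightarrow> xs = ys"
  using bij_str_code by (meson bij_is_inj inj_eq)

lemma str_code_append: "str_code (xs @ ys) = str_code xs + 2 ^ length xs * str_code ys"
  by (induction xs) (auto simp: algebra_simps)

lemma str_code_bounds: "2 ^ length xs \<le> str_code xs + 1" "str_code xs + 1 < 2 ^ Suc (length xs)"
  by (induction xs) auto

text \<open>The digits of bijective base 2 are 1 and 2. As a bounded sum, the code of an explicitly
  described string is computable.\<close>

lemma str_code_map: "str_code (map B [0..<L]) = (\<Sum>i<L. (1 + of_bool (B i)) * 2 ^ i)"
  by (induction L) (auto simp: str_code_append)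

lemma recursive1_str_code_map:
  assumes "computable 1 (\<lambda>xs. L (xs ! 0))" "decidable 2 (\<lambda>ys. B (ys ! 1) (ys ! 0))"
  shows "recursive1 (\<lambda>n. str_code (map (B n) [0..<L n]))"
proof -
  have "decidable 2 (\<lambda>ys. B (tl ys ! 0) (hd ys))"
    using assms(2) unfolding decidable_def
    by (rule computable_cong) (auto simp: length_Suc_conv numeral_2_eq_2)
  then have "computable 1 (\<lambda>xs. \<Sum>i<L (xs ! 0). (1 + of_bool (B (xs ! 0) i)) * 2 ^ i)"
    using assms(1) by (intro computable_intros) (auto simp: numeral_2_eq_2)
  then show ?thesis by (intro recursive1I) (simp add: str_code_map)
qed

lemma prefix_map_upt_iff:
  "prefix (map B [0..<L]) (map B' [0..<L']) \<longleftrightarrow> L \<le> L' \<and> (\<forall>i<L. B i = B' i)"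
proof
  assume p: "prefix (map B [0..<L]) (map B' [0..<L'])"
  then obtain zs where z: "map B' [0..<L'] = map B [0..<L] @ zs" by (auto elim: prefixE)
  have le: "L \<le> L'" using prefix_length_le[OF p] by simp
  moreover have "B i = B' i" if "i < L" for i
    using arg_cong[OF z, of "\<lambda>xs. xs ! i"] that le by (simp add: nth_append)
  ultimately show "L \<le> L' \<and> (\<forall>i<L. B i = B' i)" by blast
next
  assume a: "L \<le> L' \<and> (\<forall>i<L. B i = B' i)"
  then have "[0..<L'] = [0..<L] @ [L..<L']" using upt_add_eq_append[of 0 L "L' - L"] by auto
  moreover have "map B' [0..<L] = map B [0..<L]" using a by auto
  ultimately have "map B' [0..<L'] = map B [0..<L] @ map B' [L..<L']" by (metis map_append)
  then show "prefix (map B [0..<L]) (map B' [0..<L'])" by (rule prefixI)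
qed

section \<open>Universal machines\<close>

text \<open>The machine looks its input up among the code words and answers for the first index
  found. Several indices may share a code word provided their outputs agree, which happens when an
  index carries more information than its code word records.\<close>

lemma universal_machine_simulates:
  assumes U: "universal_machine U"
    and code: "recursive1 (\<lambda>n. str_code (code n))"
    and out: "partial_recursive (\<lambda>n. map_option str_code (out n))"
    and pf: "\<And>n n'. prefix (code n) (code n') \<Longrightarrow> code n = code n' \<and> out n = out n'"
  obtains \<rho> where "\<And>n. U (\<rho> @ code n) = out n"
proof -
  define M where "M = (\<lambda>\<tau>. if \<exists>n. code n = \<tau> then out (LEAST n. code n = \<tau>) else None)"
  have M: "M (code n) = out n" for n
  proof -
    have "code (LEAST m. code m = code n) = code n" by (rule LeastI) simp
    then show ?thesis using pf[of "LEAST m. code m = code n" n] by (auto simp: M_def)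
  qed
  have "prefix_free_machine M"
    unfolding prefix_free_machine_def
  proof
    let ?\<theta> = "\<lambda>z. if \<exists>n. str_code (code n) = z
      then map_option str_code (out (LEAST n. str_code (code n) = z)) else None"
    have "partial_recursive ?\<theta>" by (rule partial_recursive_search[OF code out])
    moreover have "\<forall>\<tau>. ?\<theta> (str_code \<tau>) = map_option str_code (M \<tau>)" by (auto simp: M_def str_code_eq_iff)
    ultimately show "\<exists>\<theta>. partial_recursive \<theta> \<and> (\<forall>\<tau>. \<theta> (str_code \<tau>) = map_option str_code (M \<tau>))"
      by blast
    have "\<exists>n. code n = \<sigma>" if "\<sigma> \<in> dom M" for \<sigma>
      using that by (auto simp: M_def split: if_splits)
    then show "\<forall>\<sigma>\<in>dom M. \<forall>\<tau>\<in>dom M. prefix \<sigma> \<tau> \<longrightarrow> \<sigma> = \<tau>" using pf by metis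
  qed
  then obtain \<rho> where "\<And>\<tau>. U (\<rho> @ \<tau>) = M \<tau>" using U unfolding universal_machine_def by blast
  then show thesis using that M by metis
qed

text \<open>The closing \<open>False\<close> is what makes the set of these strings
  prefix-free.\<close>

definition unary :: "nat \<Rightarrow> bool list" where
  "unary x = map (\<lambda>i. i < x) [0..<Suc x]"

lemma recursive1_unary: "recursive1 (\<lambda>x. str_code (unary x))"
  unfolding unary_def by (rule recursive1_str_code_map) (intro computable_intros; simp)+

lemma prefix_unary: "prefix (unary x) (unary y) \<Longrightarrow> x = y"
  unfolding unary_def prefix_map_upt_iff by (auto dest: spec[of _ x])

definition str_decode :: "nat \<Rightarrow> bool list" where
  "str_decode = inv str_code"

lemma str_code_decode: "str_code (str_decode n) = n"
  unfolding str_decode_def using bij_str_code by (simp add: bij_is_surj surj_f_inv_f)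

text \<open>An arbitrary partial recursive function becomes a prefix-free machine once its arguments
  are written in unary. The length of the input does not matter here, only that one prefix works for
  all arguments.\<close>

lemma universal_machine_unary:
  assumes U: "universal_machine U" and \<theta>: "partial_recursive \<theta>"
  obtains \<rho> where "\<And>x. map_option str_code (U (\<rho> @ unary x)) = \<theta> x"
proof -
  have o: "map_option str_code (map_option str_decode (\<theta> x)) = \<theta> x" for x
    by (simp add: option.map_comp comp_def str_code_decode option.map_ident)
  obtain \<rho> where "\<And>x. U (\<rho> @ unary x) = map_option str_decode (\<theta> x)"
    by (rule universal_machine_simulates[OF U recursive1_unary, of "\<lambda>x. map_option str_decode (\<theta> x)"])
      (use \<theta> o prefix_unary in \<open>auto\<close>)
  then show thesis using that o by metis
qed

text \<open>Simulating the identity gives every string a description, so the \<open>LEAST\<close> in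
  \<open>prefix_complexity\<close> ranges over a nonempty set.\<close>

lemma universal_machine_surj:
  assumes U: "universal_machine U"
  shows "\<exists>\<tau>. U \<tau> = Some \<sigma>"
proof -
  have "computable 1 (\<lambda>xs. xs ! 0)" by (intro computable_intros) simp
  then have "recursive1 (\<lambda>x. x)" by (rule recursive1I)
  then have "partial_recursive Some" using partial_recursive_total by force
  then obtain \<rho> where "\<And>x. map_option str_code (U (\<rho> @ unary x)) = Some x"
    using universal_machine_unary[OF U, of Some] by metis
  then have "map_option str_code (U (\<rho> @ unary (str_code \<sigma>))) = Some (str_code \<sigma>)" by blast
  then show ?thesis by (auto simp: str_code_eq_iff)
qed

lemma prefix_complexity_le: "U \<tau> = Some \<sigma> \<Longrightarrow> prefix_complexity U \<sigma> \<le> length \<tau>"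
  unfolding prefix_complexity_def by (rule Least_le) blast

lemma prefix_complexity_witness:
  assumes "universal_machine U"
  obtains \<tau> where "U \<tau> = Some \<sigma>" "length \<tau> = prefix_complexity U \<sigma>"
proof -
  have "\<exists>\<tau>. length \<tau> = prefix_complexity U \<sigma> \<and> U \<tau> = Some \<sigma>"
    unfolding prefix_complexity_def
    by (rule LeastI_ex) (use universal_machine_surj[OF assms, of \<sigma>] in blast)
  then show thesis using that by blast
qed

section \<open>A linearly universal function\<close>

text \<open>\<open>n + 1 = 2 ^ k * (2 * x + 1)\<close> codes the pair \<open>(k, x)\<close>, linearly in \<open>x\<close>.\<close>

definition pair_fst :: "nat \<Rightarrow> nat" where
  "pair_fst n = (LEAST i. odd ((n + 1) div 2 ^ i))"

definition pair_snd :: "nat \<Rightarrow> nat" where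
  "pair_snd n = (n + 1) div 2 ^ Suc (pair_fst n)"

definition pair :: "nat \<Rightarrow> nat \<Rightarrow> nat" where
  "pair k x = 2 ^ Suc k * x + (2 ^ k - 1)"

lemma pair_plus_1: "pair k x + 1 = 2 ^ k * (2 * x + 1)"
  by (simp add: pair_def algebra_simps)

lemma pair_fst_pair [simp]: "pair_fst (pair k x) = k"
  unfolding pair_fst_def pair_plus_1
proof (rule Least_equality)
  fix i assume i: "odd (2 ^ k * (2 * x + 1) div 2 ^ i)"
  show "k \<le> i"
  proof (rule ccontr)
    assume "\<not> k \<le> i"
    then have "k = i + Suc (k - i - 1)" by simp
    then have "(2::nat) ^ k = 2 ^ i * (2 * 2 ^ (k - i - 1))" by (metis power_add power_Suc)
    then have "2 ^ k * (2 * x + 1) div 2 ^ i = 2 * 2 ^ (k - i - 1) * (2 * x + 1)"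
      by (simp only: mult.assoc) simp
    with i show False by simp
  qed
qed simp

lemma pair_snd_pair [simp]: "pair_snd (pair k x) = x"
proof -
  have "2 ^ k * (2 * x + 1) div 2 ^ Suc k = x"
    unfolding power_Suc2 by (subst div_mult_mult1) simp_all
  then show ?thesis by (simp only: pair_snd_def pair_plus_1 pair_fst_pair)
qed

lemma exists_odd_div_power_2: "0 < n \<Longrightarrow> \<exists>i. odd (n div 2 ^ i)" for n :: nat
proof (induction n rule: less_induct)
  case (less n)
  show ?case
  proof (cases "odd n")
    case True
    then show ?thesis by (intro exI[of _ 0]) simp
  next
    case False
    then have "n div 2 < n" "0 < n div 2" using less.prems by auto
    then obtain i where "odd (n div 2 div 2 ^ i)" using less.IH by blast
    then show ?thesis by (intro exI[of _ "Suc i"]) (simp add: div_mult2_eq)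
  qed
qed

lemma recursive1_pair_fst: "recursive1 pair_fst"
  unfolding pair_fst_def
proof (rule recursive1I, rule computable_Least)
  fix xs :: "nat list"
  show "\<exists>i. odd ((xs ! 0 + 1) div 2 ^ i)" by (rule exists_odd_div_power_2) simp
qed (intro computable_intros; simp)

lemma recursive1_pair_snd: "recursive1 pair_snd"
  unfolding pair_snd_def
  by (rule recursive1I, intro computable_intros computable_recursive1[OF recursive1_pair_fst]) auto

text \<open>Strings of length \<open>i\<close> are exactly those with codes \<open>n\<close>
  satisfying \<open>2 ^ i \<le> n + 1 < 2 ^ Suc i\<close>. The same function is the integer part of
  the binary logarithm of \<open>n + 1\<close>, and is used as such to round
  \<open>p\<close>.\<close>

definition str_length :: "nat \<Rightarrow> nat" where
  "str_length n = (LEAST i. n + 1 < 2 ^ Suc i)"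

lemma str_length_str_code: "str_length (str_code xs) = length xs"
  unfolding str_length_def
proof (rule Least_equality)
  fix i assume "str_code xs + 1 < 2 ^ Suc i"
  then have "(2::nat) ^ length xs < 2 ^ Suc i" using str_code_bounds(1)[of xs] by linarith
  then show "length xs \<le> i" by (simp del: power_Suc)
qed (rule str_code_bounds)

lemma recursive1_str_length: "recursive1 str_length"
  unfolding str_length_def
proof (rule recursive1I, rule computable_Least)
  fix xs :: "nat list"
  have "xs ! 0 + 1 < 2 ^ Suc (xs ! 0)" using less_exp[of "xs ! 0"] unfolding power_Suc by linarith
  then show "\<exists>i. xs ! 0 + 1 < 2 ^ Suc i" by blast
qed (intro computable_intros; simp)

text \<open>The simulation prefix of \<open>\<theta>\<close> acts as its index: a number is split
  into the code of a prefix and an argument, and \<open>U\<close> runs on the prefix followed by the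
  argument in unary. For a fixed prefix the pairing is linear in the argument. The clause
  \<open>1 \<le> a\<close> allows arguments to be moved beyond any bound.\<close>

lemma linearly_universal_exists:
  assumes U: "universal_machine U"
  obtains \<psi> where "partial_recursive \<psi>"
    "\<And>\<theta>. partial_recursive \<theta> \<Longrightarrow> \<exists>a b. 1 \<le> a \<and> (\<forall>x. \<psi> (a * x + b) = \<theta> x)"
proof -
  obtain \<upsilon> where \<upsilon>: "partial_recursive \<upsilon>" "\<And>\<tau>. \<upsilon> (str_code \<tau>) = map_option str_code (U \<tau>)"
    using U unfolding universal_machine_def prefix_free_machine_def by blast
  \<comment> \<open>This is the code of the concatenation, computed from the two codes by
    \<open>str_code_append\<close>.\<close>
  define h where "h = (\<lambda>n. pair_fst n + 2 ^ str_length (pair_fst n) * str_code (unary (pair_snd n)))"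
  have "computable 1 (\<lambda>xs. h (xs ! 0))"
    unfolding h_def
    by (intro computable_intros computable_recursive1[OF recursive1_str_length]
        computable_recursive1[OF recursive1_pair_fst] computable_recursive1[OF recursive1_pair_snd]
        computable_recursive1[OF recursive1_unary]) auto
  then have h: "recursive1 h" by (rule recursive1I)
  have hp: "h (pair (str_code \<rho>) x) = str_code (\<rho> @ unary x)" for \<rho> x
    by (simp add: h_def str_length_str_code str_code_append)
  show thesis
  proof
    show "partial_recursive (\<lambda>n. \<upsilon> (h n))" by (rule partial_recursive_comp[OF \<upsilon>(1) h])
    fix \<theta> assume "partial_recursive \<theta>"
    then obtain \<rho> where \<rho>: "\<And>x. map_option str_code (U (\<rho> @ unary x)) = \<theta> x"
      using universal_machine_unary[OF U] by blast
    have "\<upsilon> (h (2 ^ Suc (str_code \<rho>) * x + (2 ^ str_code \<rho> - 1))) = \<theta> x" for x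
      using hp[of \<rho> x] \<upsilon>(2) \<rho> unfolding pair_def by simp
    then show "\<exists>a b. 1 \<le> a \<and> (\<forall>x. \<upsilon> (h (a * x + b)) = \<theta> x)"
      by (intro exI[of _ "2 ^ Suc (str_code \<rho>)"] exI[of _ "2 ^ str_code \<rho> - 1"]) simp
  qed
qed

text \<open>Simulating a shifted copy of \<open>\<theta>\<close> moves all relevant arguments beyond \<open>N\<close>.\<close>

lemma linearly_universal_restrict:
  assumes "partial_recursive \<psi>"
    "\<And>\<theta>. partial_recursive \<theta> \<Longrightarrow> \<exists>a b. 1 \<le> a \<and> (\<forall>x. \<psi> (a * x + b) = \<theta> x)"
  shows "linearly_universal (\<lambda>n. if n < N then None else \<psi> n)"
  unfolding linearly_universal_def
proof (intro conjI allI impI)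
  show "partial_recursive (\<lambda>n. if n < N then None else \<psi> n)"
    by (rule partial_recursive_restrict[OF assms(1)])
  fix \<theta> assume \<theta>: "partial_recursive \<theta>"
  have "computable 1 (\<lambda>xs. xs ! 0 - N)" by (intro computable_intros) simp
  then have "partial_recursive (\<lambda>y. \<theta> (y - N))"
    by (intro partial_recursive_comp[OF \<theta>] recursive1I)
  then obtain a b where ab: "1 \<le> a" "\<And>y. \<psi> (a * y + b) = \<theta> (y - N)" using assms(2) by blast
  have "1 * N \<le> a * N" using ab(1) by (rule mult_le_mono1)
  then have "\<not> a * x + (a * N + b) < N" for x by linarith
  moreover have "\<psi> (a * x + (a * N + b)) = \<theta> x" for x
    using ab(2)[of "x + N"] by (simp add: algebra_simps)
  ultimately show "\<exists>a b. \<forall>x. (if a * x + b < N then None else \<psi> (a * x + b)) = \<theta> x"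
    by (intro exI[of _ a] exI[of _ "a * N + b"]) auto
qed

section \<open>Kraft's inequality and its effective converse\<close>

text \<open>Induction on a bound for the lengths: deleting the first letter splits the set into two
  prefix-free sets, each counted with half its weight. The empty string can only occur
  alone.\<close>

lemma Kraft_inequality:
  fixes A :: "bool list set"
  assumes "finite A" "\<And>x y. x \<in> A \<Longrightarrow> y \<in> A \<Longrightarrow> prefix x y \<Longrightarrow> x = y"
  shows "(\<Sum>x\<in>A. (1 / 2) ^ length x) \<le> (1 :: real)"
proof -
  have "(\<Sum>x\<in>A. (1 / 2) ^ length x) \<le> (1 :: real)"
    if "finite A" "\<And>x. x \<in> A \<Longrightarrow> length x \<le> N"
      "\<And>x y. x \<in> A \<Longrightarrow> y \<in> A \<Longrightarrow> prefix x y \<Longrightarrow> x = y" for N and A :: "bool list set"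
    using that
  proof (induction N arbitrary: A)
    case 0
    then have "A \<subseteq> {[]}" by auto
    then have "A = {} \<or> A = {[]}" by blast
    then show ?case by auto
  next
    case (Suc N)
    show ?case
    proof (cases "[] \<in> A")
      case True
      then have "A = {[]}" using Suc.prems(3)[of "[]"] by auto
      then show ?thesis by simp
    next
      case False
      define S where "S = (\<lambda>b. {x. b # x \<in> A})"
      have A: "A = (#) True ` S True \<union> (#) False ` S False"
      proof -
        have "x \<in> (#) True ` S True \<union> (#) False ` S False" if "x \<in> A" for x
          using that False by (cases x; cases "hd x") (auto simp: S_def)
        then show ?thesis by (auto simp: S_def)
      qed
      have S: "finite (S b)" "(\<Sum>x\<in>S b. (1 / 2) ^ length x) \<le> (1 :: real)" for b
      proof -
        have "(#) b ` S b \<subseteq> A" by (auto simp: S_def)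
        then show fin: "finite (S b)"
          using Suc.prems(1) by (meson finite_imageD finite_subset inj_on_Cons1)
        show "(\<Sum>x\<in>S b. (1 / 2) ^ length x) \<le> (1 :: real)"
        proof (rule Suc.IH[OF fin])
          show "length x \<le> N" if "x \<in> S b" for x
            using Suc.prems(2)[of "b # x"] that by (simp add: S_def)
          show "x = y" if "x \<in> S b" "y \<in> S b" "prefix x y" for x y
            using Suc.prems(3)[of "b # x" "b # y"] that by (simp add: S_def)
        qed
      qed
      have "(\<Sum>x\<in>A. (1 / 2) ^ length x) =
          (\<Sum>x\<in>(#) True ` S True. (1 / 2) ^ length x) + (\<Sum>x\<in>(#) False ` S False. (1 / 2) ^ length x :: real)"
        by (subst A, rule sum.union_disjoint) (use S in auto)
      also have "\<dots> = (\<Sum>x\<in>S True. (1 / 2) ^ length x) / 2 + (\<Sum>x\<in>S False. (1 / 2) ^ length x) / 2"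
        by (simp add: sum.reindex sum_divide_distrib)
      also have "\<dots> \<le> 1" using S(2)[of True] S(2)[of False] by simp
      finally show ?thesis .
    qed
  qed
  from this[of A "Max (length ` A)"] assms show ?thesis by simp
qed

section \<open>Canonical prefix codes for nondecreasing lengths\<close>

lemma eq_if_bits_eq:
  fixes a b :: nat
  assumes "a < 2 ^ L" "b < 2 ^ L" "\<And>j. j < L \<Longrightarrow> odd (a div 2 ^ j) = odd (b div 2 ^ j)"
  shows "a = b"
proof -
  have "bit a j = bit b j" if "j < L" for j using assms(3)[OF that] by (simp add: bit_iff_odd)
  then have "take_bit L a = take_bit L b"
    by (intro bit_eqI) (auto simp: bit_take_bit_iff)
  then show ?thesis using assms(1,2) by (simp add: take_bit_nat_eq_self)
qed

text \<open>For nondecreasing lengths the dyadic intervals of size \<open>2 ^ (- l n)\<close> can be laid side by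
  side from left to right; \<open>canonical_index l n\<close> is the position of the \<open>n\<close>th.\<close>

definition canonical_index :: "(nat \<Rightarrow> nat) \<Rightarrow> nat \<Rightarrow> nat" where
  "canonical_index l n = (\<Sum>i<n. 2 ^ (l n - l i))"

text \<open>The most significant bit comes first, so that being a prefix corresponds to containment
  of dyadic intervals.\<close>

definition canonical_code :: "(nat \<Rightarrow> nat) \<Rightarrow> nat \<Rightarrow> bool list" where
  "canonical_code l n = map (\<lambda>i. odd (canonical_index l n div 2 ^ (l n - 1 - i))) [0..<l n]"

lemma recursive1_canonical_code:
  assumes "recursive1 l"
  shows "recursive1 (\<lambda>n. str_code (canonical_code l n))"
proof -
  have "computable 1 (\<lambda>xs. canonical_index l (xs ! 0))"
    unfolding canonical_index_def
    by (intro computable_intros computable_recursive1[OF assms]) auto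
  then have "recursive1 (canonical_index l)" by (rule recursive1I)
  then show ?thesis unfolding canonical_code_def
    by (intro recursive1_str_code_map computable_intros computable_recursive1[OF assms]
        computable_recursive1[of "canonical_index l"]) auto
qed

text \<open>The Kraft sum up to and including \<open>n\<close>, scaled by \<open>2 ^ l n\<close>, is
  the index plus one; so the interval still fits into the unit interval and its index has at most
  \<open>l n\<close> binary digits.\<close>

lemma canonical_index_less:
  assumes "mono l" "(\<Sum>i<Suc n. (1 / 2) ^ l i) \<le> (1 :: real)"
  shows "canonical_index l n < 2 ^ l n"
proof -
  have "real (canonical_index l n + 1) = (\<Sum>i<Suc n. 2 ^ (l n - l i))"
    by (simp add: canonical_index_def)
  also have "\<dots> = (\<Sum>i<Suc n. 2 ^ l n * (1 / 2) ^ l i)"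
    using assms(1) by (intro sum.cong) (auto simp: monoD power_diff power_one_over)
  also have "\<dots> \<le> 2 ^ l n"
    using assms(2) unfolding sum_distrib_left[symmetric] by (simp add: mult_left_le del: sum.lessThan_Suc)
  finally have "real (canonical_index l n + 1) \<le> real (2 ^ l n)" by simp
  then show ?thesis unfolding of_nat_le_iff by simp
qed

text \<open>Pulling \<open>2 ^ (l n - l m)\<close> out of the summands \<open>i \<le> m\<close> of
  the later index leaves the earlier index, plus one for the interval of \<open>m\<close> itself.
  Monotonicity of \<open>l\<close> makes the exponents add up exactly.\<close>

lemma canonical_index_step:
  assumes "mono l" "m < n"
  shows "canonical_index l m < canonical_index l n div 2 ^ (l n - l m)"
proof -
  have le: "l i \<le> l m" "l m \<le> l n" if "i \<le> m" for i
    using assms that by (auto intro: monoD)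
  have "(canonical_index l m + 1) * 2 ^ (l n - l m) = (\<Sum>i<Suc m. 2 ^ (l m - l i) * 2 ^ (l n - l m))"
    by (simp add: canonical_index_def sum_distrib_right)
  also have "\<dots> = (\<Sum>i<Suc m. 2 ^ (l n - l i))"
  proof (intro sum.cong refl)
    fix i assume "i \<in> {..<Suc m}"
    then have "l m - l i + (l n - l m) = l n - l i" using le[of i] by simp
    then show "(2::nat) ^ (l m - l i) * 2 ^ (l n - l m) = 2 ^ (l n - l i)"
      by (simp flip: power_add)
  qed
  also have "\<dots> \<le> canonical_index l n"
    unfolding canonical_index_def using assms(2) by (intro sum_mono2) auto
  finally have "canonical_index l m + 1 \<le> canonical_index l n div 2 ^ (l n - l m)"
    by (subst less_eq_div_iff_mult_less_eq) auto
  then show ?thesis by simp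
qed

text \<open>A prefix relation says that the later index, truncated to \<open>l m\<close> bits,
  equals the index of \<open>m\<close>, against \<open>canonical_index_step\<close> if
  \<open>m < n\<close>. If \<open>n < m\<close>, monotonicity forces equal lengths, and the same
  step applies with nothing to truncate.\<close>

lemma prefix_canonical_code:
  assumes l: "mono l" "\<And>n. (\<Sum>i<n. (1 / 2) ^ l i) \<le> (1 :: real)"
    and p: "prefix (canonical_code l m) (canonical_code l n)"
  shows "m = n"
proof -
  note less = canonical_index_less[OF l(1) l(2)]
  have le: "l m \<le> l n" and bits: "\<And>i. i < l m \<Longrightarrow>
      odd (canonical_index l m div 2 ^ (l m - 1 - i)) = odd (canonical_index l n div 2 ^ (l n - 1 - i))"
    using p unfolding canonical_code_def prefix_map_upt_iff by auto
  have eq: "canonical_index l m = canonical_index l n div 2 ^ (l n - l m)"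
  proof (rule eq_if_bits_eq[OF less])
    have "canonical_index l n < 2 ^ (l n - l m) * 2 ^ l m"
      using less[of n] le by (simp flip: power_add)
    then show "canonical_index l n div 2 ^ (l n - l m) < 2 ^ l m"
      by (simp add: less_mult_imp_div_less mult.commute)
    fix j assume "j < l m"
    then have "l m - 1 - (l m - 1 - j) = j" "l n - 1 - (l m - 1 - j) = (l n - l m) + j"
      using le by auto
    then show "odd (canonical_index l m div 2 ^ j) =
        odd (canonical_index l n div 2 ^ (l n - l m) div 2 ^ j)"
      using bits[of "l m - 1 - j"] \<open>j < l m\<close> by (simp add: power_add div_mult2_eq)
  qed
  show ?thesis
  proof (rule linorder_cases[of m n])
    assume "m < n"
    then show ?thesis using canonical_index_step[OF l(1)] eq by fastforce
  next
    assume "n < m"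
    then have "l n = l m" using le l(1) by (simp add: monoD order_antisym)
    then show ?thesis using canonical_index_step[OF l(1) \<open>n < m\<close>] eq by simp
  qed
qed

text \<open>The monotone case of the Kraft-Chaitin theorem. The constant is the length of the
  simulation prefix; code words are reserved also for those \<open>n\<close> at which
  \<open>out\<close> is undefined, so the allocation stays recursive.\<close>

lemma prefix_complexity_le_length:
  assumes U: "universal_machine U"
    and l: "recursive1 l" "mono l" "\<And>n. (\<Sum>i<n. (1 / 2) ^ l i) \<le> (1 :: real)"
    and out: "partial_recursive (\<lambda>n. map_option str_code (out n))"
  obtains c where "\<And>n \<sigma>. out n = Some \<sigma> \<Longrightarrow> prefix_complexity U \<sigma> \<le> l n + c"
proof -
  obtain \<rho> where \<rho>: "\<And>n. U (\<rho> @ canonical_code l n) = out n"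
    by (rule universal_machine_simulates[OF U recursive1_canonical_code[OF l(1)] out])
      (use prefix_canonical_code[OF l(2,3)] in blast)+
  have "prefix_complexity U \<sigma> \<le> l n + length \<rho>" if "out n = Some \<sigma>" for n \<sigma>
    using prefix_complexity_le[of U "\<rho> @ canonical_code l n" \<sigma>] \<rho> that
    by (simp add: canonical_code_def)
  then show thesis by (rule that)
qed

section \<open>Sequences avoiding a small set of strings\<close>

text \<open>A path is built that keeps \<open>f \<sigma> < w \<sigma>\<close>, where
  \<open>f \<sigma>\<close> is the weight of the members of \<open>B\<close> extending
  \<open>\<sigma>\<close>. At a position in \<open>D\<close> the allowance \<open>w\<close> does not
  shrink, so the bit may be prescribed; elsewhere it is halved, and one of the two extensions keeps
  the inequality because \<open>f\<close> splits between them. A member of \<open>B\<close> on the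
  path would contribute its own weight to \<open>f\<close>. The bound \<open>1 / 2\<close> makes the
  inequality strict at the root, where \<open>w\<close> is 1.\<close>

lemma exists_sequence_avoiding:
  fixes B :: "bool list set" and d :: "nat \<Rightarrow> nat" and D :: "nat set"
  assumes d: "d 0 = 0" "\<And>n. d (Suc n) = (if n \<in> D then d n else Suc (d n))"
    and small: "\<And>F. finite F \<Longrightarrow> F \<subseteq> B \<Longrightarrow> (\<Sum>\<tau>\<in>F. (1 / 2) ^ d (length \<tau>)) \<le> (1 / 2 :: real)"
  obtains X :: "nat \<Rightarrow> bool" where "\<And>k. k \<in> D \<Longrightarrow> \<not> X k" "\<And>n. map X [0..<n] \<notin> B"
proof -
  define w :: "bool list \<Rightarrow> real" where "w = (\<lambda>\<tau>. (1 / 2) ^ d (length \<tau>))"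
  define E where "E = (\<lambda>\<sigma>. {\<tau> \<in> B. prefix \<sigma> \<tau>})"
  define f where "f = (\<lambda>\<sigma>. infsum w (E \<sigma>))"
  have w0: "0 \<le> w \<tau>" for \<tau> by (simp add: w_def)
  have sB: "w summable_on B"
  proof (rule nonneg_bdd_above_summable_on[OF w0 bdd_aboveI2[where M = "1 / 2"]])
    fix F assume "F \<in> {F. F \<subseteq> B \<and> finite F}"
    then show "sum w F \<le> 1 / 2" unfolding w_def using small by blast
  qed
  have sE: "w summable_on E \<sigma>" for \<sigma>
    using sB by (rule summable_on_subset_banach) (auto simp: E_def)
  have f_Nil: "f [] < 1"
  proof -
    have "f [] \<le> 1 / 2" unfolding f_def
    proof (rule infsum_le_finite_sums[OF sE])
      fix F assume "finite F" "F \<subseteq> E []"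
      moreover from this have "F \<subseteq> B" by (auto simp: E_def)
      ultimately show "sum w F \<le> 1 / 2" unfolding w_def using small by blast
    qed
    then show ?thesis by simp
  qed
  have f_mono: "f (\<sigma> @ [b]) \<le> f \<sigma>" for \<sigma> b
    unfolding f_def
    by (rule infsum_mono2[OF sE sE]) (auto simp: E_def w0 dest: append_prefixD)
  have f_split: "f (\<sigma> @ [True]) + f (\<sigma> @ [False]) \<le> f \<sigma>" for \<sigma>
  proof -
    have disj: "E (\<sigma> @ [True]) \<inter> E (\<sigma> @ [False]) = {}"
      by (auto simp: E_def prefix_def)
    have "f (\<sigma> @ [True]) + f (\<sigma> @ [False]) = infsum w (E (\<sigma> @ [True]) \<union> E (\<sigma> @ [False]))"
      unfolding f_def by (rule infsum_Un_disjoint[symmetric, OF sE sE disj])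
    also have "\<dots> \<le> f \<sigma>"
      unfolding f_def
      by (rule infsum_mono2[OF summable_on_Un_disjoint[OF sE sE disj] sE])
        (auto simp: E_def w0 dest: append_prefixD)
    finally show ?thesis .
  qed
  have notin: "\<sigma> \<notin> B" if "f \<sigma> < w \<sigma>" for \<sigma>
  proof
    assume "\<sigma> \<in> B"
    then have "infsum w {\<sigma>} \<le> f \<sigma>"
      unfolding f_def by (intro infsum_mono2 sE) (auto simp: E_def w0)
    then show False using that by simp
  qed
  have "\<exists>p. \<forall>n. (length (p n) = n \<and> f (p n) < w (p n)) \<and>
      (\<exists>b. p (Suc n) = p n @ [b] \<and> (n \<in> D \<longrightarrow> \<not> b))"
  proof (rule dependent_nat_choice)
    show "\<exists>x. length x = 0 \<and> f x < w x" using f_Nil by (simp add: w_def d)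
    fix \<sigma> n assume \<sigma>: "length \<sigma> = n \<and> f \<sigma> < w \<sigma>"
    then have l: "length \<sigma> = n" and less: "f \<sigma> < (1 / 2) ^ d n" by (auto simp: w_def)
    have "\<exists>b. (n \<in> D \<longrightarrow> \<not> b) \<and> f (\<sigma> @ [b]) < w (\<sigma> @ [b])"
    proof (cases "n \<in> D")
      case True
      then have "f (\<sigma> @ [False]) < w (\<sigma> @ [False])"
        using less f_mono[of \<sigma> False] by (simp add: w_def d l)
      then show ?thesis by blast
    next
      case False
      have "f (\<sigma> @ [True]) < w (\<sigma> @ [True]) \<or> f (\<sigma> @ [False]) < w (\<sigma> @ [False])"
        using less f_split[of \<sigma>] False by (simp add: w_def d l) linarith
      then show ?thesis using False by blast
    qed
    then show "\<exists>y. (length y = Suc n \<and> f y < w y) \<and> (\<exists>b. y = \<sigma> @ [b] \<and> (n \<in> D \<longrightarrow> \<not> b))"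
      using \<sigma> by force
  qed
  then obtain p where p: "\<And>n. length (p n) = n" "\<And>n. f (p n) < w (p n)"
    "\<And>n. \<exists>b. p (Suc n) = p n @ [b] \<and> (n \<in> D \<longrightarrow> \<not> b)" by blast
  define X where "X = (\<lambda>k. p (Suc k) ! k)"
  have pX: "p (Suc n) = p n @ [X n]" "n \<in> D \<Longrightarrow> \<not> X n" for n
  proof -
    obtain b where b: "p (Suc n) = p n @ [b]" "n \<in> D \<longrightarrow> \<not> b" using p(3) by blast
    then have "X n = b" using p(1)[of n] by (simp add: X_def nth_append)
    with b show "p (Suc n) = p n @ [X n]" "n \<in> D \<Longrightarrow> \<not> X n" by auto
  qed
  have "map X [0..<n] = p n" for n
    by (induction n) (use p(1)[of 0] pX in auto)
  then show thesis using that[of X] pX(2) notin p(2) by metis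
qed

section \<open>Integer bounds extracted from the order function\<close>

lemma real_divide_less_div_plus_1:
  assumes "0 < n" shows "real m / real n < real (m div n) + 1"
proof -
  have "m < (m div n + 1) * n" using dividend_less_div_times[OF assms, of m] by simp
  then have "real m < real ((m div n + 1) * n)" unfolding of_nat_less_iff .
  then show ?thesis using assms by (simp add: pos_divide_less_eq distrib_right)
qed

text \<open>Scaling by \<open>2 ^ k\<close> turns the error into at most 1, and rounding down loses
  less than 1 more; adding 2 gives an upper bound, too large by at most 3. A negative approximation
  is cut off at 0 by the truncated \<open>a - b\<close>, which is harmless for
  \<open>0 \<le> x\<close>.\<close>

lemma approximation_bounds:
  fixes x :: real
  assumes "0 \<le> x" "\<bar>x - (real a - real b) / (real d + 1)\<bar> \<le> 1 / 2 ^ k"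
  shows "x * 2 ^ k \<le> real ((2 ^ k * (a - b)) div Suc d + 2)"
    and "real ((2 ^ k * (a - b)) div Suc d + 2) \<le> x * 2 ^ k + 3"
proof -
  define q where "q = (real a - real b) / (real d + 1)"
  define N where "N = 2 ^ k * (a - b)"
  have "\<bar>x - q\<bar> * 2 ^ k \<le> 1 / 2 ^ k * 2 ^ k"
    using assms(2) unfolding q_def by (rule mult_right_mono) simp
  then have x: "\<bar>x * 2 ^ k - q * 2 ^ k\<bar> \<le> 1" by (simp add: abs_mult flip: left_diff_distrib)
  have fl: "real (N div Suc d) \<le> real N / real (Suc d)" "real N / real (Suc d) < real (N div Suc d) + 1"
    by (rule of_nat_div_le_of_nat, rule real_divide_less_div_plus_1) simp
  have "x * 2 ^ k \<le> real (N div Suc d + 2) \<and> real (N div Suc d + 2) \<le> x * 2 ^ k + 3"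
  proof (cases "b \<le> a")
    case True
    then have "real N / real (Suc d) = q * 2 ^ k" by (simp add: N_def q_def of_nat_diff add.commute)
    then show ?thesis using x fl by auto
  next
    case False
    then have "q \<le> 0" by (simp add: q_def divide_nonpos_pos)
    then have "q * 2 ^ k \<le> 0" by (simp add: mult_nonpos_nonneg)
    moreover have "0 \<le> x * 2 ^ k" using assms(1) by simp
    ultimately show ?thesis using x False by (simp add: N_def)
  qed
  then show "x * 2 ^ k \<le> real ((2 ^ k * (a - b)) div Suc d + 2)"
    and "real ((2 ^ k * (a - b)) div Suc d + 2) \<le> x * 2 ^ k + 3" by (simp_all add: N_def)
qed

lemma uniformly_computable_upper:
  assumes "uniformly_computable f" "\<And>n. 0 \<le> f n"
  obtains u where "recursive2 u" "\<And>n k. f n * 2 ^ k \<le> real (u n k)"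
    "\<And>n k. real (u n k) \<le> f n * 2 ^ k + 3"
proof -
  obtain a b d where r: "recursive2 a" "recursive2 b" "recursive2 d"
    and q: "\<And>n k. \<bar>f n - (real (a n k) - real (b n k)) / (real (d n k) + 1)\<bar> \<le> 1 / 2 ^ k"
    using assms(1) unfolding uniformly_computable_def by blast
  have "computable 2 (\<lambda>xs. (2 ^ (xs ! 1) * (a (xs ! 0) (xs ! 1) - b (xs ! 0) (xs ! 1)))
      div Suc (d (xs ! 0) (xs ! 1)) + 2)"
    by (intro computable_intros r[THEN computable_recursive2]) auto
  then have "recursive2 (\<lambda>n k. (2 ^ k * (a n k - b n k)) div Suc (d n k) + 2)" by (rule recursive2I)
  then show thesis
    by (rule that) (rule approximation_bounds[OF assms(2) q])+
qed

lemma computable_real_upper: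
  assumes "computable_real x" "0 \<le> x"
  obtains u where "recursive1 u" "\<And>k. x * 2 ^ k \<le> real (u k)" "\<And>k. real (u k) \<le> x * 2 ^ k + 3"
proof -
  obtain a b d where r: "recursive1 a" "recursive1 b" "recursive1 d"
    and q: "\<And>k. \<bar>x - (real (a k) - real (b k)) / (real (d k) + 1)\<bar> \<le> 1 / 2 ^ k"
    using assms(1) unfolding computable_real_def by blast
  have "computable 1 (\<lambda>xs. (2 ^ (xs ! 0) * (a (xs ! 0) - b (xs ! 0))) div Suc (d (xs ! 0)) + 2)"
    by (intro computable_intros r[THEN computable_recursive1]) auto
  then have "recursive1 (\<lambda>k. (2 ^ k * (a k - b k)) div Suc (d k) + 2)" by (rule recursive1I)
  then show thesis
    by (rule that) (rule approximation_bounds[OF assms(2) q])+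
qed

section \<open>Rounding the order function to powers of two\<close>

lemma str_length_bounds: "2 ^ str_length n \<le> n + 1" "n + 1 < 2 ^ Suc (str_length n)"
  using str_code_bounds[of "str_decode n"] str_length_str_code[of "str_decode n"]
  by (simp_all add: str_code_decode)

text \<open>Rounded approximations of \<open>p\<close> may fluctuate even though \<open>p\<close> is
  monotone. \<open>M\<close> is therefore their running maximum, which still satisfies
  \<open>2 ^ M n \<le> p n\<close> because \<open>p\<close> is nondecreasing.\<close>

lemma exists_dyadic_order:
  fixes p :: "nat \<Rightarrow> real"
  assumes "uniformly_computable p" "mono p" "\<And>n. 1 < p n"
  obtains M where "recursive1 M" "mono M" "\<And>n. 2 ^ M n \<le> p n" "\<And>n. p n \<le> 8 * 2 ^ M n"
proof -
  obtain u where u: "recursive2 u" "\<And>n k. p n * 2 ^ k \<le> real (u n k)"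
    "\<And>n k. real (u n k) \<le> p n * 2 ^ k + 3"
    using uniformly_computable_upper[OF assms(1)] assms(3) by (metis less_eq_real_def less_trans zero_less_one)
  \<comment> \<open>\<open>u n 0\<close> exceeds \<open>p n\<close> by at most 3 and
    \<open>str_length\<close> refers to its argument plus one, hence the 4. If
    \<open>u n 0 < 4\<close>, the truncated difference gives exponent 0, and \<open>1 < p n\<close>
    suffices.\<close>
  define m where "m = (\<lambda>n. str_length (u n 0 - 4))"
  define M where "M = (\<lambda>n. rec_nat (m 0) (\<lambda>i r. if r \<le> m (Suc i) then m (Suc i) else r) n)"
  have rm: "recursive1 m"
    unfolding m_def
    by (rule recursive1I, intro computable_intros computable_recursive1[OF recursive1_str_length]
        computable_recursive2[OF u(1)]) auto
  have m_le: "2 ^ m n \<le> p n" for n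
  proof -
    have "real (2 ^ m n) \<le> real (u n 0 - 4 + 1)"
      unfolding m_def of_nat_le_iff by (rule str_length_bounds)
    then show ?thesis using u(3)[of n 0] assms(3)[of n] by (cases "4 \<le> u n 0") (auto simp: of_nat_diff)
  qed
  have m_ge: "p n \<le> 8 * 2 ^ m n" for n
  proof -
    have "u n 0 - 4 + 1 < 2 * 2 ^ m n" unfolding m_def using str_length_bounds(2)[of "u n 0 - 4"] by simp
    then have "u n 0 \<le> 8 * 2 ^ m n" by linarith
    then have "real (u n 0) \<le> real (8 * 2 ^ m n)" unfolding of_nat_le_iff .
    then show ?thesis using u(2)[of n 0] by simp
  qed
  show thesis
  proof
    show "recursive1 M"
      unfolding M_def
      by (rule recursive1I, intro computable_intros computable_rec computable_recursive1[OF rm]) auto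
    show "mono M" unfolding mono_iff_le_Suc by (simp add: M_def)
    show "2 ^ M n \<le> p n" for n
    proof (induction n)
      case 0
      then show ?case using m_le[of 0] by (simp add: M_def)
    next
      case (Suc n)
      moreover have "p n \<le> p (Suc n)" using assms(2) by (simp add: monoD)
      ultimately show ?case using m_le[of "Suc n"] by (simp add: M_def)
    qed
    have "m n \<le> M n" for n by (cases n) (auto simp: M_def)
    then have "(2::real) ^ m n \<le> 2 ^ M n" for n by (simp add: power_increasing)
    then show "p n \<le> 8 * 2 ^ M n" for n using m_ge[of n] by (meson mult_left_mono order_trans zero_le_numeral)
  qed
qed

lemma linear_over_exp_tendsto_0: "(\<lambda>k. (4 * real k + 3) / 2 ^ k) \<longlonglongrightarrow> 0"
proof -
  have "(\<lambda>k. 4 * (real k * (1 / 2) ^ k) + 3 * (1 / 2) ^ k) \<longlonglongrightarrow> 4 * 0 + 3 * 0"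
    by (intro tendsto_intros powser_times_n_limit_0 LIMSEQ_power_zero) auto
  moreover have "4 * (real k * (1 / 2) ^ k) + 3 * (1 / 2) ^ k = (4 * real k + 3) / 2 ^ k" for k
    by (simp add: power_one_over add_divide_distrib)
  ultimately show ?thesis by simp
qed

text \<open>The sum is approximated from above by \<open>A k / 2 ^ k\<close> and its first
  \<open>k\<close> terms from below by \<open>T k / 2 ^ k\<close>, so any \<open>k\<close> passing
  the integer test bounds the true tail. The search ends because the total error, at most
  \<open>(4 * k + 3) / 2 ^ k\<close>, tends to 0 along with the tail.\<close>

lemma exists_recursive_modulus:
  fixes p :: "nat \<Rightarrow> real"
  assumes "uniformly_computable p" "\<And>n. 1 < p n" "summable (\<lambda>n. inverse (p n))"
    and S: "computable_real (\<Sum>n. inverse (p n))"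
  obtains N where "recursive1 N"
    "\<And>j. (\<Sum>n. inverse (p n)) - (\<Sum>n<N j. inverse (p n)) \<le> (1 / 4) ^ j"
proof -
  define S where "S = (\<Sum>n. inverse (p n))"
  define P where "P = (\<lambda>k. \<Sum>n<k. inverse (p n))"
  have p0: "0 < p n" for n using assms(2)[of n] by simp
  then have "0 \<le> S" unfolding S_def by (intro suminf_nonneg assms(3)) (simp add: less_imp_le)
  then obtain A where A: "recursive1 A" "\<And>k. S * 2 ^ k \<le> real (A k)" "\<And>k. real (A k) \<le> S * 2 ^ k + 3"
    using computable_real_upper S unfolding S_def by metis
  obtain u where u: "recursive2 u" "\<And>n k. p n * 2 ^ k \<le> real (u n k)"
    "\<And>n k. real (u n k) \<le> p n * 2 ^ k + 3"
    using uniformly_computable_upper[OF assms(1)] p0 by (metis less_eq_real_def)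
  \<comment> \<open>As \<open>u n k\<close> is an upper estimate of \<open>p n * 2 ^ k\<close>, the
    quotient is a lower estimate of \<open>2 ^ k / p n\<close>.\<close>
  define T where "T = (\<lambda>k. \<Sum>n<k. 4 ^ k div u n k)"
  have u0: "0 < real (u n k)" for n k
    by (rule less_le_trans[OF _ u(2)]) (simp add: p0)
  have T_le: "real (T k) \<le> P k * 2 ^ k" for k
  proof -
    have "real (4 ^ k div u n k) \<le> inverse (p n) * 2 ^ k" for n
    proof -
      have "real (4 ^ k div u n k) \<le> real (4 ^ k) / real (u n k)" by (rule of_nat_div_le_of_nat)
      also have "\<dots> \<le> 4 ^ k / (p n * 2 ^ k)"
        using u(2)[of n k] u0[of n k] p0[of n] by (auto intro!: divide_left_mono)
      also have "(4::real) ^ k = 2 ^ k * 2 ^ k" by (simp flip: power_mult_distrib)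
      finally show ?thesis using p0[of n] by (simp add: field_simps)
    qed
    then show ?thesis unfolding T_def P_def of_nat_sum sum_distrib_right by (rule sum_mono)
  qed
  \<comment> \<open>Each term loses at most 3 through the excess of \<open>u\<close> and at most 1
    through integer division.\<close>
  have T_ge: "P k * 2 ^ k - 4 * k \<le> real (T k)" for k
  proof -
    have "inverse (p n) * 2 ^ k - 4 \<le> real (4 ^ k div u n k)" for n
    proof -
      define x where "x = (2::real) ^ k"
      have x: "1 \<le> x" by (simp add: x_def)
      have "inverse (p n) * x - 3 \<le> x * x / (p n * x + 3)"
      proof -
        have "(inverse (p n) * x - 3) * (p n * x + 3) = x * x + 3 * (x / p n) - 3 * (p n * x) - 9"
          using p0[of n] by (simp add: field_simps)
        also have "\<dots> \<le> x * x"
        proof -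
          have "x / p n \<le> x" using assms(2)[of n] x by (simp add: divide_le_eq)
          moreover have "x \<le> p n * x" using assms(2)[of n] x by simp
          ultimately show ?thesis by linarith
        qed
        finally show ?thesis using p0[of n] x by (subst pos_le_divide_eq) (auto intro: add_pos_pos)
      qed
      also have "\<dots> \<le> x * x / real (u n k)"
        using u(3)[of n k] u0[of n k] p0[of n] x unfolding x_def
        by (intro divide_left_mono) (auto intro!: mult_pos_pos add_pos_pos)
      also have "x * x = real (4 ^ k)" by (simp add: x_def flip: power_mult_distrib)
      also have "real (4 ^ k) / real (u n k) \<le> real (4 ^ k div u n k) + 1"
        using real_divide_less_div_plus_1[of "u n k" "4 ^ k"] u0[of n k] by simp
      finally show ?thesis by (simp add: x_def)
    qed
    then have "(\<Sum>n<k. inverse (p n) * 2 ^ k - 4) \<le> (\<Sum>n<k. real (4 ^ k div u n k))" by (rule sum_mono)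
    then show ?thesis unfolding T_def P_def 
      by (simp add: sum_subtractf mult.commute flip: sum_distrib_right)
  qed
  have ex: "\<exists>k. 4 ^ j * (A k - T k) \<le> 2 ^ k" for j
  proof -
    have "P \<longlonglongrightarrow> S" unfolding P_def S_def by (rule summable_LIMSEQ[OF assms(3)])
    then have "(\<lambda>k. S - P k + (4 * real k + 3) / 2 ^ k) \<longlonglongrightarrow> S - S + 0"
      by (intro tendsto_intros linear_over_exp_tendsto_0)
    then have "eventually (\<lambda>k. S - P k + (4 * real k + 3) / 2 ^ k < (1 / 4) ^ j) sequentially"
      by (rule order_tendstoD) simp
    then obtain k where "S - P k + (4 * real k + 3) / 2 ^ k < (1 / 4) ^ j"
      by (auto simp: eventually_sequentially)
    then have "(S - P k + (4 * real k + 3) / 2 ^ k) * 2 ^ k \<le> (1 / 4) ^ j * 2 ^ k"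
      by (intro mult_right_mono) auto
    moreover have "(S - P k + (4 * real k + 3) / 2 ^ k) * 2 ^ k = S * 2 ^ k - P k * 2 ^ k + (4 * real k + 3)"
      by (simp only: distrib_right left_diff_distrib) simp
    ultimately have "S * 2 ^ k - P k * 2 ^ k + (4 * real k + 3) \<le> (1 / 4) ^ j * 2 ^ k" by simp
    then have "real (A k) - real (T k) \<le> (1 / 4) ^ j * 2 ^ k"
      using A(3)[of k] T_ge[of k] by linarith
    moreover have "real (A k - T k) = max 0 (real (A k) - real (T k))" by (simp add: of_nat_diff max_def)
    ultimately have "real (A k - T k) \<le> (1 / 4) ^ j * 2 ^ k" by simp
    then have "real (4 ^ j * (A k - T k)) \<le> real (2 ^ k)" by (simp add: power_one_over field_simps)
    then show ?thesis unfolding of_nat_le_iff by blast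
  qed
  define N where "N = (\<lambda>j. LEAST k. 4 ^ j * (A k - T k) \<le> 2 ^ k)"
  show thesis
  proof
    have "computable 1 (\<lambda>xs. T (xs ! 0))"
      unfolding T_def by (intro computable_intros computable_recursive2[OF u(1)]) auto
    then have T: "recursive1 T" by (rule recursive1I)
    show "recursive1 N"
      unfolding N_def
      by (rule recursive1I, rule computable_Least[OF _ ex], intro computable_intros
          computable_recursive1[OF A(1)] computable_recursive1[OF T]) auto
    fix j
    have "4 ^ j * (A (N j) - T (N j)) \<le> 2 ^ N j" unfolding N_def by (rule LeastI_ex[OF ex])
    then have "real (4 ^ j * (A (N j) - T (N j))) \<le> real (2 ^ N j)" unfolding of_nat_le_iff .
    then have "real (A (N j) - T (N j)) \<le> (1 / 4) ^ j * 2 ^ N j" by (simp add: power_one_over field_simps)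
    moreover have "real (A (N j)) - real (T (N j)) \<le> real (A (N j) - T (N j))" by linarith
    ultimately have "(S - P (N j)) * 2 ^ N j \<le> (1 / 4) ^ j * 2 ^ N j"
      using A(2)[of "N j"] T_le[of "N j"] by (simp add: left_diff_distrib)
    then show "(\<Sum>n. inverse (p n)) - (\<Sum>n<N j. inverse (p n)) \<le> (1 / 4) ^ j"
      by (simp add: S_def P_def)
  qed
qed

text \<open>Transfers the modulus from positions to lengths: since \<open>t j\<close> exceeds
  \<open>M (N j)\<close> and \<open>M\<close> is monotone, \<open>t j \<le> M i\<close> forces
  \<open>i\<close> past \<open>N j\<close>. The factor 8 is the loss in rounding
  \<open>p\<close>.\<close>

lemma exists_effective_tail_bounds:
  fixes p :: "nat \<Rightarrow> real"
  assumes "fast_growing p" "computable_real (\<Sum>n. inverse (p n))"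
  obtains M t :: "nat \<Rightarrow> nat" and c :: real where
    "recursive1 M" "mono M" "\<And>n. 2 ^ M n \<le> p n" "filterlim M at_top sequentially"
    "recursive1 t" "strict_mono t" "\<And>j. j < t j"
    "\<And>n. (\<Sum>i<n. (1 / 2) ^ M i) \<le> c"
    "\<And>j n. (\<Sum>i | i < n \<and> t j \<le> M i. (1 / 2) ^ M i) \<le> 8 * (1 / 4 :: real) ^ j"
proof -
  have p: "uniformly_computable p" "mono p" "\<not> bdd_above (range p)" "\<And>n. 1 < p n"
    and sum: "summable (\<lambda>n. inverse (p n))"
    using assms(1) by (auto simp: fast_growing_def order_function_def)
  have p0: "0 < p n" for n using p(4)[of n] by simp
  obtain M where M: "recursive1 M" "mono M" "\<And>n. 2 ^ M n \<le> p n" "\<And>n. p n \<le> 8 * 2 ^ M n"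
    using exists_dyadic_order[OF p(1,2,4)] by blast
  obtain N where N: "recursive1 N"
    "\<And>j. (\<Sum>n. inverse (p n)) - (\<Sum>n<N j. inverse (p n)) \<le> (1 / 4) ^ j"
    using exists_recursive_modulus[OF p(1,4) sum assms(2)] by blast
  \<comment> \<open>Adding up the earlier values, each increased by one, makes \<open>t\<close>
    strictly increasing with \<open>j < t j\<close>.\<close>
  define t where "t = (\<lambda>j. \<Sum>i<Suc j. M (N i) + 1)"
  have half: "(1 / 2) ^ M i \<le> 8 * inverse (p i)" for i
  proof -
    have "inverse (8 * 2 ^ M i) \<le> inverse (p i)" using M(4) p0 by (rule le_imp_inverse_le)
    then show ?thesis by (simp add: power_one_over inverse_eq_divide field_simps)
  qed
  show thesis
  proof
    show "filterlim M at_top sequentially"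
      unfolding filterlim_at_top eventually_sequentially
    proof
      fix Z :: nat
      obtain n where n: "8 * 2 ^ Z < p n"
        using p(3) unfolding bdd_above_def by (metis not_le rangeE)
      have "Z \<le> M k" if "n \<le> k" for k
      proof -
        have "8 * 2 ^ Z < (8 * 2 ^ M n :: real)" using n M(4)[of n] by linarith
        then have "Z < M n" by simp
        then show ?thesis using monoD[OF M(2) that] by simp
      qed
      then show "\<exists>N. \<forall>n\<ge>N. Z \<le> M n" by blast
    qed
    have "computable 1 (\<lambda>xs. t (xs ! 0))" unfolding t_def
      by (intro computable_intros computable_recursive1[OF M(1)] computable_recursive1[OF N(1)]) auto
    then show "recursive1 t" by (rule recursive1I)
    show "strict_mono t" by (simp add: strict_mono_Suc_iff t_def)
    show "j < t j" for j by (induction j) (auto simp: t_def)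
    show "(\<Sum>i<n. (1 / 2) ^ M i) \<le> 8 * (\<Sum>i. inverse (p i))" for n
    proof -
      have "(\<Sum>i<n. (1 / 2) ^ M i) \<le> (\<Sum>i<n. 8 * inverse (p i))" by (intro sum_mono half)
      also have "\<dots> = 8 * (\<Sum>i<n. inverse (p i))" by (simp add: sum_distrib_left)
      also have "\<dots> \<le> 8 * (\<Sum>i. inverse (p i))"
        using sum_le_suminf[OF sum, of "{..<n}"] p0 by (auto simp: less_imp_le)
      finally show ?thesis .
    qed
    show "(\<Sum>i | i < n \<and> t j \<le> M i. (1 / 2) ^ M i) \<le> 8 * (1 / 4 :: real) ^ j" for j n
    proof -
      have "N j \<le> i" if "t j \<le> M i" for i
      proof (rule ccontr)
        assume "\<not> N j \<le> i"
        then have "M i \<le> M (N j)" using M(2) by (simp add: monoD)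
        then show False using that by (simp add: t_def)
      qed
      then have sub: "{i. i < n \<and> t j \<le> M i} \<subseteq> {..<n} - {..<N j}" by auto
      have "(\<Sum>i | i < n \<and> t j \<le> M i. (1 / 2) ^ M i) \<le>
          (\<Sum>i\<in>{..<n} - {..<N j}. 8 * inverse (p i))"
        by (rule order_trans[OF sum_mono sum_mono2])
          (use half sub p0 in \<open>auto simp: less_imp_le\<close>)
      also have "\<dots> = 8 * ((\<Sum>i\<in>{..<n} \<union> {..<N j}. inverse (p i)) - (\<Sum>i<N j. inverse (p i)))"
        by (simp add: sum_distrib_left[symmetric] sum_diff[symmetric] Un_Diff)
      also have "\<dots> \<le> 8 * ((\<Sum>i. inverse (p i)) - (\<Sum>i<N j. inverse (p i)))"
        using sum_le_suminf[OF sum, of "{..<n} \<union> {..<N j}"] p0 by (auto simp: less_imp_le)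
      also have "\<dots> \<le> 8 * (1 / 4) ^ j" using N(2)[of j] by simp
      finally show ?thesis .
    qed
  qed (rule M)+
qed

section \<open>Slowly growing counting functions\<close>

text \<open>A discrete inverse of \<open>t\<close>. When \<open>j < t j\<close> for all
  \<open>j\<close>, the bound \<open>j < m\<close> loses nothing, and it turns the count into a
  computable finite sum.\<close>

definition count_le :: "(nat \<Rightarrow> nat) \<Rightarrow> nat \<Rightarrow> nat" where
  "count_le t m = (\<Sum>j<m. of_bool (t j \<le> m))"

context
  fixes t :: "nat \<Rightarrow> nat"
  assumes t: "strict_mono t" "\<And>j. j < t j"
begin

text \<open>As \<open>t\<close> is increasing, the \<open>j\<close> with \<open>t j \<le> m\<close>
  form an initial segment, so counting them locates its end. The other facts in this context use
  \<open>count_le\<close> only through this equivalence and its consequences.\<close>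

lemma less_count_le_iff: "j < count_le t m \<longleftrightarrow> t j \<le> m"
proof -
  define c where "c = (LEAST j. m < t j)"
  have c: "m < t c" unfolding c_def by (rule LeastI[of _ m]) (rule t)
  have iff: "t j \<le> m \<longleftrightarrow> j < c" for j
  proof
    assume "t j \<le> m"
    then have "t j < t c" using c by simp
    then show "j < c" using t(1) by (simp add: strict_mono_less)
  next
    assume "j < c"
    then have "\<not> m < t j" unfolding c_def by (rule not_less_Least)
    then show "t j \<le> m" by simp
  qed
  have "c \<le> m" unfolding c_def by (rule Least_le) (rule t)
  have "count_le t m = card ({..<m} \<inter> {j. t j \<le> m})" by (simp add: count_le_def)
  also have "{..<m} \<inter> {j. t j \<le> m} = {..<c}"
    unfolding iff using \<open>c \<le> m\<close> by auto
  finally have "count_le t m = c" by simp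
  then show ?thesis using iff[of j] by simp
qed

lemma count_le_le: "count_le t m \<le> m"
  using less_count_le_iff[of m m] t(2)[of m] by simp

lemma mono_count_le: "mono (count_le t)"
proof (rule monoI, rule ccontr)
  fix m n :: nat assume "m \<le> n" "\<not> count_le t m \<le> count_le t n"
  then have "count_le t n < count_le t m" by simp
  then have "t (count_le t n) \<le> m" unfolding less_count_le_iff .
  then show False using less_count_le_iff[of "count_le t n" n] \<open>m \<le> n\<close> by simp
qed

text \<open>Values of a strictly increasing integer sequence are at least one apart, so a step of
  \<open>m\<close> passes at most one of them. Monotonicity of \<open>g\<close> and of the code
  lengths rests on this.\<close>

lemma count_le_Suc: "count_le t (Suc m) \<le> Suc (count_le t m)"
proof (rule ccontr)
  assume "\<not> ?thesis"
  then have "Suc (count_le t m) < count_le t (Suc m)" by simp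
  then have "t (Suc (count_le t m)) \<le> Suc m" unfolding less_count_le_iff .
  moreover have "t (count_le t m) < t (Suc (count_le t m))" using t(1) by (simp add: strict_mono_Suc_iff)
  ultimately show False using less_count_le_iff[of "count_le t m" m] by simp
qed

lemma filterlim_count_le: "filterlim (count_le t) at_top sequentially"
  unfolding filterlim_at_top eventually_sequentially
proof
  fix Z
  have "Z \<le> count_le t n" if "t Z \<le> n" for n using less_count_le_iff[of Z n] that by simp
  then show "\<exists>N. \<forall>n\<ge>N. Z \<le> count_le t n" by blast
qed

lemma mono_diff_count_le: "mono (\<lambda>m. m - count_le t m)"
  unfolding mono_iff_le_Suc
proof
  fix m show "m - count_le t m \<le> Suc m - count_le t (Suc m)"
    using count_le_Suc[of m] by linarith
qed

text \<open>Expanding \<open>2 ^ b\<close> as \<open>1 + (\<Sum>j<b. 2 ^ j)\<close> and exchanging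
  the sums leaves the original series plus its tails weighted by \<open>2 ^ j\<close>; the latter
  amount to at most \<open>8 * (\<Sum>j<M n. (1 / 2) ^ j) \<le> 16\<close>.\<close>

lemma sum_over_count_le:
  fixes M :: "nat \<Rightarrow> nat" and c :: real
  assumes "mono M" "\<And>n. (\<Sum>i<n. (1 / 2) ^ M i) \<le> c"
    and tail: "\<And>j n. (\<Sum>i | i < n \<and> t j \<le> M i. (1 / 2) ^ M i) \<le> 8 * (1 / 4 :: real) ^ j"
  shows "(\<Sum>i<n. (1 / 2) ^ (M i - count_le t (M i))) \<le> c + 16"
proof -
  have pow: "(2::real) ^ b = 1 + (\<Sum>j<b. 2 ^ j)" for b by (induction b) auto
  have summand: "(1 / 2) ^ (M i - count_le t (M i)) =
      (1 / 2) ^ M i + (\<Sum>j<M n. of_bool (t j \<le> M i) * (2 ^ j * (1 / 2 :: real) ^ M i))" if "i < n" for i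
  proof -
    have le: "count_le t (M i) \<le> M n"
      using count_le_le[of "M i"] monoD[OF assms(1), of i n] that by simp
    have "(1 / 2 :: real) ^ (M i - count_le t (M i)) = 2 ^ count_le t (M i) * (1 / 2) ^ M i"
      using count_le_le[of "M i"] by (simp add: power_diff power_one_over)
    also have "\<dots> = (1 / 2) ^ M i + (\<Sum>j<count_le t (M i). 2 ^ j * (1 / 2) ^ M i)"
      by (subst pow) (simp add: distrib_right sum_distrib_right)
    \<comment> \<open>The inner range is enlarged to one independent of \<open>i\<close>, as the
      exchange of sums requires; the indicator cancels the added terms.\<close>
    also have "(\<Sum>j<count_le t (M i). 2 ^ j * (1 / 2) ^ M i) =
        (\<Sum>j<M n. of_bool (t j \<le> M i) * (2 ^ j * (1 / 2 :: real) ^ M i))"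
    proof (rule sum.mono_neutral_cong_left)
      show "\<forall>j\<in>{..<M n} - {..<count_le t (M i)}. of_bool (t j \<le> M i) * (2 ^ j * (1 / 2 :: real) ^ M i) = 0"
        by (simp flip: less_count_le_iff)
      show "2 ^ j * (1 / 2) ^ M i = of_bool (t j \<le> M i) * (2 ^ j * (1 / 2 :: real) ^ M i)"
        if "j \<in> {..<count_le t (M i)}" for j
        using that by (simp add: less_count_le_iff)
    qed (use le in auto)
    finally show ?thesis .
  qed
  have "(\<Sum>i<n. (1 / 2) ^ (M i - count_le t (M i))) =
      (\<Sum>i<n. (1 / 2) ^ M i) +
      (\<Sum>i<n. \<Sum>j<M n. of_bool (t j \<le> M i) * (2 ^ j * (1 / 2 :: real) ^ M i))"
    unfolding sum.distrib[symmetric] by (intro sum.cong refl summand) simp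
  also have "(\<Sum>i<n. \<Sum>j<M n. of_bool (t j \<le> M i) * (2 ^ j * (1 / 2 :: real) ^ M i)) =
      (\<Sum>j<M n. 2 ^ j * (\<Sum>i<n. of_bool (t j \<le> M i) * (1 / 2) ^ M i))"
    unfolding sum_distrib_left by (subst sum.swap) (intro sum.cong refl, simp only: mult_ac)
  also have "\<dots> \<le> (\<Sum>j<M n. 2 ^ j * (8 * (1 / 4) ^ j))"
  proof (intro sum_mono mult_left_mono)
    fix j
    have "(\<Sum>i<n. of_bool (t j \<le> M i) * (1 / 2 :: real) ^ M i) =
        (\<Sum>i | i < n \<and> t j \<le> M i. (1 / 2) ^ M i)"
      by (intro sum.mono_neutral_cong_right) auto
    then show "(\<Sum>i<n. of_bool (t j \<le> M i) * (1 / 2 :: real) ^ M i) \<le> 8 * (1 / 4) ^ j"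
      using tail by simp
  qed simp
  also have "\<dots> = 8 * (\<Sum>j<M n. (1 / 2) ^ j)"
  proof -
    have "(2::real) ^ j * (1 / 4) ^ j = (1 / 2) ^ j" for j
      unfolding power_mult_distrib[symmetric] by simp
    then show ?thesis unfolding sum_distrib_left by (intro sum.cong refl) simp
  qed
  also have "(\<Sum>j<M n. (1 / 2 :: real) ^ j) \<le> 2"
    by (simp add: sum_gp_strict)
  finally show ?thesis using assms(2)[of n] by simp
qed

end

lemma recursive1_count_le: "recursive1 t \<Longrightarrow> recursive1 (count_le t)"
  unfolding count_le_def
  by (rule recursive1I, intro computable_intros computable_recursive1[of t]) auto

section \<open>Separation from Martin-Loef randomness\<close>

lemma exists_nat_with_bits: "\<exists>v::nat. \<forall>j<L. odd (v div 2 ^ j) = Q j"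
proof -
  have "\<forall>j<L. bit (horner_sum of_bool 2 (map Q [0..<L]) :: nat) j = Q j"
    by (simp add: bit_horner_sum_bit_iff)
  then show ?thesis by (auto simp: bit_iff_odd)
qed

lemma initial_segment_of_bool: "initial_segment (\<lambda>k. of_bool (X k)) n = map X [0..<n]"
  by (simp add: initial_segment_def of_bool_def)

text \<open>Shortest descriptions of distinct strings form a prefix-free set, to which Kraft's
  inequality applies. The strict \<open><\<close> saves one further bit, whence \<open>1 / 2\<close>
  instead of 1.\<close>

lemma low_complexity_strings_small:
  assumes U: "universal_machine U" and "finite F" "\<And>\<tau>. \<tau> \<in> F \<Longrightarrow> prefix_complexity U \<tau> < d \<tau>"
  shows "(\<Sum>\<tau>\<in>F. (1 / 2) ^ d \<tau>) \<le> (1 / 2 :: real)"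
proof -
  have "\<exists>\<tau>. U \<tau> = Some \<sigma> \<and> length \<tau> = prefix_complexity U \<sigma>" for \<sigma>
    by (rule prefix_complexity_witness[OF U, of \<sigma>]) blast
  note ex = someI_ex[OF this]
  define \<pi> where "\<pi> = (\<lambda>\<sigma>. SOME \<tau>. U \<tau> = Some \<sigma> \<and> length \<tau> = prefix_complexity U \<sigma>)"
  have "U (\<pi> \<sigma>) = Some \<sigma> \<and> length (\<pi> \<sigma>) = prefix_complexity U \<sigma>" for \<sigma>
    unfolding \<pi>_def by (rule ex)
  note \<pi> = conjunct1[OF this] conjunct2[OF this]
  have inj: "inj_on \<pi> F"
    by (rule inj_on_inverseI[where g = "\<lambda>\<tau>. the (U \<tau>)"]) (simp only: \<pi> option.sel)
  have "(\<Sum>\<tau>\<in>F. (1 / 2) ^ d \<tau>) \<le> (\<Sum>\<tau>\<in>F. (1 / 2 :: real) ^ Suc (length (\<pi> \<tau>)))"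
    using assms(3) \<pi>(2) by (intro sum_mono power_decreasing) (auto simp: Suc_le_eq)
  also have "\<dots> = (\<Sum>\<rho>\<in>\<pi> ` F. (1 / 2 :: real) ^ length \<rho>) / 2"
    using inj by (simp add: sum.reindex sum_divide_distrib)
  also have "(\<Sum>\<rho>\<in>\<pi> ` F. (1 / 2 :: real) ^ length \<rho>) \<le> 1"
  proof (rule Kraft_inequality)
    show "x = y" if "x \<in> \<pi> ` F" "y \<in> \<pi> ` F" "prefix x y" for x y
    proof -
      have "x \<in> dom U" "y \<in> dom U" using that \<pi>(1) by auto
      then show ?thesis using U that(3) unfolding universal_machine_def prefix_free_machine_def by blast
    qed
  qed (use assms in auto)
  finally show ?thesis by simp
qed

text \<open>The witness has zeros at the jumps of \<open>s\<close> and is as complex as possible elsewhere. Each zero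
  saves one bit, and describing \<open>i\<close> in unary costs only half of the \<open>2 * i\<close> bits saved up to
  \<open>r i\<close>.\<close>

lemma COMPLEX_neq_MLR:
  assumes U: "universal_machine U"
    and s: "recursive1 s" "s 0 = 0" "\<And>n. s (Suc n) = s n \<or> s (Suc n) = Suc (s n)"
    and r: "recursive1 r" "\<And>i. 2 * i \<le> s (r i)"
  shows "COMPLEX U (\<lambda>n. real (n - s n)) \<noteq> MLR U"
proof -
  \<comment> \<open>\<open>d n\<close> is the number of positions below \<open>n\<close> outside
    \<open>D\<close>, that is, of the freely chosen bits.\<close>
  define d where "d = (\<lambda>n. n - s n)"
  define D where "D = {k. s (Suc k) \<noteq> s k}"
  have sle: "s n \<le> n" for n by (induction n) (use s(2) s(3) in \<open>auto, metis le_SucI not_less_eq_eq\<close>)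
  have d0: "d 0 = 0" and dSuc: "d (Suc n) = (if n \<in> D then d n else Suc (d n))" for n
    using s(3)[of n] sle[of n] by (auto simp: d_def D_def s(2))
  have dmono: "mono d" unfolding mono_iff_le_Suc by (simp add: dSuc)
  have rd: "recursive1 d" unfolding d_def
    by (rule recursive1I, intro computable_intros computable_recursive1[OF s(1)]) auto
  have "(\<Sum>\<tau>\<in>F. (1 / 2) ^ d (length \<tau>)) \<le> (1 / 2 :: real)"
    if "finite F" "F \<subseteq> {\<sigma>. prefix_complexity U \<sigma> < d (length \<sigma>)}" for F
    by (rule low_complexity_strings_small[OF U that(1)]) (use that(2) in auto)
  then obtain X :: "nat \<Rightarrow> bool" where X: "\<And>k. k \<in> D \<Longrightarrow> \<not> X k"
    "\<And>n. map X [0..<n] \<notin> {\<sigma>. prefix_complexity U \<sigma> < d (length \<sigma>)}"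
    using exists_sequence_avoiding[OF d0 dSuc, of "{\<sigma>. prefix_complexity U \<sigma> < d (length \<sigma>)}"]
    by blast
  define Z where "Z = (\<lambda>k. of_bool (X k) :: nat)"
  have "Z \<in> COMPLEX U (\<lambda>n. real (n - s n))"
    using X(2) unfolding COMPLEX_def Z_def
    by (auto intro!: exI[of _ 0] simp: d_def not_less initial_segment_of_bool)
  moreover have "Z \<notin> MLR U"
  proof
    assume "Z \<in> MLR U"
    then obtain c where c: "\<And>n. real n - real c \<le> real (prefix_complexity U (map X [0..<n]))"
      unfolding MLR_def COMPLEX_def Z_def by (auto simp: initial_segment_of_bool)
    \<comment> \<open>An index \<open>n\<close> codes a stage \<open>I n\<close> and a number
      \<open>V n\<close> holding the free bits below \<open>r (I n)\<close>. The code word is the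
      stage in unary followed by these bits; the unary part determines the total length, so no code
      word properly extends another. Higher bits of \<open>V n\<close> affect neither code nor
      output.\<close>
    define I where "I = pair_fst"
    define V where "V = pair_snd"
    define B where "B = (\<lambda>n k. k < I n \<or> I n < k \<and> odd (V n div 2 ^ (k - Suc (I n))))"
    define code where "code = (\<lambda>n. map (B n) [0..<Suc (I n) + d (r (I n))])"
    \<comment> \<open>The decoder puts a zero at each jump and the free bit of rank
      \<open>d k\<close> at any other \<open>k\<close>.\<close>
    define S where "S = (\<lambda>n k. s (Suc k) = s k \<and> odd (V n div 2 ^ d k))"
    define out where "out = (\<lambda>n. Some (map (S n) [0..<r (I n)]))"
    note rules = computable_intros computable_recursive1[OF s(1)]
      computable_recursive1[OF r(1)] computable_recursive1[OF rd]
      computable_recursive1[OF recursive1_pair_fst] computable_recursive1[OF recursive1_pair_snd]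
    have code: "recursive1 (\<lambda>n. str_code (code n))"
      unfolding code_def B_def I_def V_def by (rule recursive1_str_code_map; intro rules; simp)
    have "recursive1 (\<lambda>n. str_code (map (S n) [0..<r (I n)]))"
      unfolding S_def I_def V_def by (rule recursive1_str_code_map; intro rules; simp)
    then have out: "partial_recursive (\<lambda>n. map_option str_code (out n))"
      unfolding out_def option.map by (rule partial_recursive_total)
    have pf: "code n = code n' \<and> out n = out n'" if "prefix (code n) (code n')" for n n'
    proof -
      have len: "Suc (I n) + d (r (I n)) \<le> Suc (I n') + d (r (I n'))"
        and eq: "\<And>k. k < Suc (I n) + d (r (I n)) \<Longrightarrow> B n k = B n' k"
        using that unfolding code_def prefix_map_upt_iff by auto
      have I: "I n = I n'"
        using eq[of "I n"] eq[of "I n'"] by (cases "I n" "I n'" rule: linorder_cases) (auto simp: B_def)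
      have bits: "odd (V n div 2 ^ j) = odd (V n' div 2 ^ j)" if "j < d (r (I n))" for j
        using eq[of "Suc (I n) + j"] that I by (simp add: B_def)
      have "S n k = S n' k" if "k < r (I n)" for k
      proof (cases "k \<in> D")
        case False
        then have "Suc (d k) \<le> d (r (I n))" using dSuc[of k] monoD[OF dmono, of "Suc k" "r (I n)"] that by simp
        then show ?thesis using bits[of "d k"] by (simp add: S_def)
      qed (simp add: S_def D_def)
      then show ?thesis using eq I by (simp add: code_def out_def)
    qed
    obtain \<rho> where \<rho>: "\<And>n. U (\<rho> @ code n) = out n"
      using universal_machine_simulates[OF U code out pf] by blast
    \<comment> \<open>Comparing \<open>r i - c\<close> with the description length
      \<open>length \<rho> + Suc i + d (r i)\<close>, where
      \<open>d (r i) + 2 * i \<le> r i\<close>, yields \<open>i < c + length \<rho> + 2\<close>;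
      this value is the least that refutes it.\<close>
    define i where "i = c + length \<rho> + 2"
    \<comment> \<open>The bits of \<open>X\<close> at free positions, listed by rank;
      \<open>d\<close> is injective outside \<open>D\<close>, so \<open>Q\<close> is
      unambiguous.\<close>
    define Q where "Q = (\<lambda>j. \<exists>k. k \<notin> D \<and> d k = j \<and> X k)"
    obtain v :: nat where v: "\<And>j. j < d (r i) \<Longrightarrow> odd (v div 2 ^ j) = Q j"
      using exists_nat_with_bits[of "d (r i)" Q] by blast
    have dinj: "k = k'" if "k \<notin> D" "k' \<notin> D" "d k = d k'" for k k'
    proof -
      have "\<not> k < k'" if "k \<notin> D" "d k = d k'" for k k'
        using dSuc[of k] monoD[OF dmono, of "Suc k" k'] that by auto
      then show ?thesis using that by (metis linorder_neqE_nat)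
    qed
    have "S (pair i v) k = X k" if "k < r i" for k
    proof (cases "k \<in> D")
      case True
      then show ?thesis using X(1) by (simp add: S_def D_def)
    next
      case False
      then have "Suc (d k) \<le> d (r i)" using dSuc[of k] monoD[OF dmono, of "Suc k" "r i"] that by simp
      then have "odd (v div 2 ^ d k) = Q (d k)" using v by simp
      also have "Q (d k) = X k" using dinj False unfolding Q_def by blast
      finally show ?thesis using False by (simp add: S_def D_def V_def)
    qed
    then have "out (pair i v) = Some (map X [0..<r i])" by (simp add: out_def I_def)
    then have "prefix_complexity U (map X [0..<r i]) \<le> length (\<rho> @ code (pair i v))"
      using \<rho> by (intro prefix_complexity_le) simp
    also have "\<dots> = length \<rho> + Suc i + d (r i)" by (simp add: code_def I_def)
    finally have "real (r i) \<le> real (c + length \<rho> + Suc i + d (r i))"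
      using c[of "r i"] by linarith
    then have "r i \<le> c + length \<rho> + Suc i + d (r i)" unfolding of_nat_le_iff .
    moreover have "d (r i) + 2 * i \<le> r i" using r(2)[of i] sle[of "r i"] unfolding d_def by linarith
    ultimately have "i < c + length \<rho> + 2" by linarith
    then show False by (simp add: i_def)
  qed
  ultimately show ?thesis by blast
qed

section \<open>Avoidance from complexity\<close>

text \<open>This is the reduction itself. It queries the oracle, so its recursion is assembled
  directly from the schemes instead of through the closure properties of
  \<open>computable\<close>.\<close>

lemma exists_prefix_value_program:
  assumes "recursive1 M"
  obtains e where "\<And>X n. recf_eval X e [n] = Some (\<Sum>i<M n. X i * 2 ^ i)"
proof -
  obtain m where m: "\<And>X n. recf_eval X m [n] = Some (M n)"
    using recursive1E[OF assms] by metis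
  have "computable 3 (\<lambda>xs. xs ! 2 + xs ! 1 * 2 ^ (xs ! 0))" by (intro computable_intros) auto
  then obtain q where q: "\<And>X xs. length xs = 3 \<Longrightarrow>
      recf_eval X q xs = Some (xs ! 2 + xs ! 1 * 2 ^ (xs ! 0))"
    unfolding computable_def by blast
  define G where "G = RComp q [RProj 0, RComp ROracle [RProj 0], RProj 1]"
  have G: "recf_eval X G [i, v] = Some (v + X i * 2 ^ i)" for X i v
    by (simp add: G_def q)
  have "recf_eval X (RPrec RZero G) [N] = Some (\<Sum>i<N. X i * 2 ^ i)" for X N
    by (induction N) (auto simp: G)
  then have "recf_eval X (RComp (RPrec RZero G) [m]) [n] = Some (\<Sum>i<M n. X i * 2 ^ i)" for X n
    by (simp add: m del: recf_eval.simps(6))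
  then show thesis by (rule that)
qed

lemma binary_sum_bits:
  assumes "\<And>i. X i \<in> {0, 1}"
  shows "(\<Sum>i<N. X i * 2 ^ i) < (2 :: nat) ^ N"
    and "map (\<lambda>j. odd ((\<Sum>i<N. X i * 2 ^ i) div 2 ^ j)) [0..<N] = initial_segment X N"
proof -
  have X: "X i = of_bool (X i = 1)" for i using assms[of i] by auto
  show "(\<Sum>i<N. X i * 2 ^ i) < (2 :: nat) ^ N"
  proof (induction N)
    case (Suc N)
    have "X N * 2 ^ N \<le> 2 ^ N" using assms[of N] by auto
    with Suc show ?case unfolding sum.lessThan_Suc power_Suc by linarith
  qed simp
  have "(\<Sum>i<N. X i * 2 ^ i) = horner_sum of_bool 2 (map (\<lambda>i. X i = 1) [0..<N])"
    unfolding horner_sum_eq_sum by (rule sum.cong) (use X in auto)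
  then show "map (\<lambda>j. odd ((\<Sum>i<N. X i * 2 ^ i) div 2 ^ j)) [0..<N] = initial_segment X N"
    by (simp add: initial_segment_def bit_horner_sum_bit_iff flip: bit_iff_odd)
qed

text \<open>The function sending \<open>n\<close> to the first \<open>M n\<close> bits of
  \<open>\<psi> n\<close> does not mention \<open>X\<close>, so the constant \<open>b\<close> is
  uniform. Only \<open>c\<close>, and with it the cutoff \<open>N\<close>, depends on
  \<open>X\<close>; the reduction stays uniform because \<open>LUA\<close> lets the linearly
  universal function vary with the sequence.\<close>

lemma LUA_reducible_COMPLEX:
  fixes p g :: "nat \<Rightarrow> real"
  assumes U: "universal_machine U"
    and M: "recursive1 M" "\<And>n. 2 ^ M n \<le> p n"
    and l: "recursive1 l" "mono l" "\<And>n. (\<Sum>i<n. (1 / 2) ^ l i) \<le> (1 :: real)"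
    and gap: "filterlim (\<lambda>n. g (M n) - real (l n)) at_top sequentially"
  shows "strongly_reducible (LUA p) (COMPLEX U g)"
proof -
  obtain \<psi> where \<psi>: "partial_recursive \<psi>"
    "\<And>\<theta>. partial_recursive \<theta> \<Longrightarrow> \<exists>a b. 1 \<le> a \<and> (\<forall>x. \<psi> (a * x + b) = \<theta> x)"
    using linearly_universal_exists[OF U] by blast
  define bits where "bits = (\<lambda>n (y :: nat). map (\<lambda>j. odd (y div 2 ^ j)) [0..<M n])"
  have "computable 2 (\<lambda>xs. \<Sum>j<M (xs ! 0). (1 + of_bool (odd (xs ! 1 div 2 ^ j))) * 2 ^ j)"
    by (intro computable_intros computable_recursive1[OF M(1)]) auto
  then have "recursive2 (\<lambda>n y. str_code (bits n y))"
    unfolding bits_def str_code_map by (rule recursive2I)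
  then have "partial_recursive (\<lambda>n. map_option (\<lambda>y. str_code (bits n y)) (\<psi> n))"
    by (rule partial_recursive_map_option[OF _ \<psi>(1)])
  then have "partial_recursive (\<lambda>n. map_option str_code (map_option (bits n) (\<psi> n)))"
    by (simp add: option.map_comp comp_def)
  then obtain b where b: "\<And>n \<sigma>. map_option (bits n) (\<psi> n) = Some \<sigma> \<Longrightarrow> prefix_complexity U \<sigma> \<le> l n + b"
    using prefix_complexity_le_length[OF U l, of "\<lambda>n. map_option (bits n) (\<psi> n)"] by blast
  obtain e where e: "\<And>X n. recf_eval X e [n] = Some (\<Sum>i<M n. X i * 2 ^ i)"
    using exists_prefix_value_program[OF M(1)] by blast
  show ?thesis
    unfolding strongly_reducible_def
  proof (intro exI[of _ e] ballI)
    fix X assume "X \<in> COMPLEX U g"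
    then obtain c where X: "\<And>i. X i \<in> {0, 1}"
      and c: "\<And>n. g n - real c \<le> real (prefix_complexity U (initial_segment X n))"
      unfolding COMPLEX_def by blast
    define Y where "Y = (\<lambda>n. \<Sum>i<M n. X i * 2 ^ i)"
    \<comment> \<open>The extra 1 makes the lower bound from \<open>c\<close> strictly exceed the
      upper bound \<open>l n + b\<close>.\<close>
    have "eventually (\<lambda>n. real c + real b + 1 \<le> g (M n) - real (l n)) sequentially"
      using gap unfolding filterlim_at_top by blast
    then obtain N where N: "\<And>n. N \<le> n \<Longrightarrow> real c + real b + 1 \<le> g (M n) - real (l n)"
      unfolding eventually_sequentially by blast
    have avoid: "\<psi> n \<noteq> Some (Y n)" if "N \<le> n" for n
    proof
      assume "\<psi> n = Some (Y n)"
      then have "map_option (bits n) (\<psi> n) = Some (initial_segment X (M n))"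
        using binary_sum_bits(2)[of X "M n", OF X] by (simp add: bits_def Y_def)
      then have "prefix_complexity U (initial_segment X (M n)) \<le> l n + b" by (rule b)
      then show False using c[of "M n"] N[OF that] by linarith
    qed
    have "Y \<in> LUA p"
      unfolding LUA_def mem_Collect_eq
    proof
      show "\<forall>n. real (Y n) < p n"
      proof
        fix n
        have "real (Y n) < real (2 ^ M n)"
          unfolding Y_def of_nat_less_iff by (rule binary_sum_bits(1)[of X, OF X])
        then have "real (Y n) < 2 ^ M n" unfolding of_nat_power of_nat_numeral .
        then show "real (Y n) < p n" using M(2)[of n] by linarith
      qed
      show "\<exists>\<psi>. linearly_universal \<psi> \<and> \<not> (\<exists>n\<in>dom \<psi>. \<psi> n = Some (Y n))"
      proof (intro exI conjI)
        show "linearly_universal (\<lambda>n. if n < N then None else \<psi> n)"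
          by (rule linearly_universal_restrict[OF \<psi>(1)]) (rule \<psi>(2))
        show "\<not> (\<exists>n\<in>dom (\<lambda>n. if n < N then None else \<psi> n).
            (if n < N then None else \<psi> n) = Some (Y n))"
          using avoid by auto
      qed
    qed
    then show "\<exists>Y\<in>LUA p. \<forall>n. recf_eval X e [n] = Some (Y n)"
      using e unfolding Y_def by (intro bexI) auto
  qed
qed

section \<open>The choice of \<open>g\<close> and its properties\<close>

theorem mainTheorem2:
  fixes U :: "bool list \<Rightarrow> bool list option" and p :: "nat \<Rightarrow> real"
  assumes "universal_machine U"
    and "fast_growing p"
    and "computable_real (\<Sum>n. inverse (p n))"
  shows "\<exists>g :: nat \<Rightarrow> real.
           order_function g \<and> convex_seq g \<and> sub_identical g \<and>
           strongly_reducible (LUA p) (COMPLEX U g) \<and>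
           COMPLEX U g \<noteq> MLR U"
proof -
  obtain M t c where M: "recursive1 M" "mono M" "\<And>n. 2 ^ M n \<le> p n" "filterlim M at_top sequentially"
    and t: "recursive1 t" "strict_mono t" "\<And>j. j < t j"
    and sum: "\<And>n. (\<Sum>i<n. (1 / 2) ^ M i) \<le> (c :: real)"
      "\<And>j n. (\<Sum>i | i < n \<and> t j \<le> M i. (1 / 2) ^ M i) \<le> 8 * (1 / 4 :: real) ^ j"
    by (rule exists_effective_tail_bounds[OF assms(2,3)]) blast
  define q where "q = count_le t"
  note q = count_le_le[OF t(2,3), folded q_def] mono_count_le[OF t(2,3), folded q_def]
    count_le_Suc[OF t(2,3), folded q_def] filterlim_count_le[OF t(2,3), folded q_def]
    mono_diff_count_le[OF t(2,3), folded q_def]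
  have rq: "recursive1 q" unfolding q_def by (rule recursive1_count_le[OF t(1)])
  define s where "s = (\<lambda>n. q n div 2)"
  have rs: "recursive1 s" unfolding s_def
    by (rule recursive1I, intro computable_intros computable_recursive1[OF rq]) auto
  \<comment> \<open>Keeps \<open>g n\<close> at or above \<open>n / 2\<close>, hence
    unbounded.\<close>
  have s_le: "2 * s n \<le> n" for n using q(1)[of n] unfolding s_def by linarith
  have s_Suc: "s (Suc n) = s n \<or> s (Suc n) = Suc (s n)" for n
    using q(3)[of n] monoD[OF q(2), of n "Suc n"] unfolding s_def by (simp, presburger)
  have s_top: "filterlim (\<lambda>n. real (s n)) at_top sequentially"
  proof -
    have "filterlim s at_top sequentially"
      unfolding s_def filterlim_at_top
    proof
      fix Z :: nat
      have "eventually (\<lambda>n. 2 * Z \<le> q n) sequentially" using q(4) unfolding filterlim_at_top by blast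
      then show "eventually (\<lambda>n. Z \<le> q n div 2) sequentially" by eventually_elim linarith
    qed
    then show ?thesis by (rule filterlim_compose[OF filterlim_real_sequentially])
  qed
  define g where "g = (\<lambda>n. real (n - s n))"
  have g_step: "g n \<le> g (Suc n)" "g (Suc n) \<le> g n + 1" for n
    using s_Suc[of n] s_le[of n] s_le[of "Suc n"] unfolding g_def by linarith+
  have "mono g" unfolding mono_iff_le_Suc using g_step(1) by blast
  have "order_function g"
    unfolding order_function_def
  proof (intro conjI notI)
    have "computable 2 (\<lambda>xs. xs ! 0 - s (xs ! 0))"
      by (intro computable_intros computable_recursive1[OF rs]) auto
    then have a: "recursive2 (\<lambda>n k. n - s n)" by (rule recursive2I)
    have "computable 2 (\<lambda>xs. 0)" by (rule computable_const)
    then have z: "recursive2 (\<lambda>n k. 0)" by (rule recursive2I)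
    show "uniformly_computable g"
      unfolding uniformly_computable_def g_def
      by (rule exI[of _ "\<lambda>n k. n - s n"], rule exI[of _ "\<lambda>n k. 0"], rule exI[of _ "\<lambda>n k. 0"])
        (use a z in simp)
    assume "bdd_above (range g)"
    then obtain b where b: "\<And>n. g n \<le> b" unfolding bdd_above_def by blast
    obtain n where "2 * b < real n" using reals_Archimedean2 by blast
    then show False using b[of n] s_le[of n] unfolding g_def by linarith
  qed (rule \<open>mono g\<close>)
  moreover have "convex_seq g"
    unfolding convex_seq_def using \<open>mono g\<close> g_step(2) by (simp add: algebra_simps)
  moreover have "sub_identical g"
  proof -
    have "real n - g n = real (s n)" for n using s_le[of n] unfolding g_def by linarith
    then show ?thesis unfolding sub_identical_def using s_top by (simp add: g_def)
  qed
  moreover have "strongly_reducible (LUA p) (COMPLEX U g)"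
  proof -
    \<comment> \<open>Lengthening every code by \<open>C\<close> divides the Kraft sum, at most
      \<open>c + 16\<close>, by \<open>2 ^ C\<close>; a constant does not affect the divergence of
      the gap.\<close>
    obtain C :: nat where C: "c + 16 \<le> 2 ^ C"
      using real_arch_pow[of 2 "c + 16"] by (auto intro: less_imp_le)
    define l where "l = (\<lambda>n. M n - q (M n) + C)"
    show ?thesis
    proof (rule LUA_reducible_COMPLEX[OF assms(1) M(1,3)])
      show "recursive1 l" unfolding l_def
        by (rule recursive1I, intro computable_intros computable_recursive1[OF M(1)]
            computable_recursive1[OF rq]) auto
      show "mono l" unfolding l_def
        by (rule monoI) (use monoD[OF q(5) monoD[OF M(2)]] in simp)
      show "(\<Sum>i<n. (1 / 2) ^ l i) \<le> (1 :: real)" for n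
      proof -
        have "(\<Sum>i<n. (1 / 2) ^ l i) = (\<Sum>i<n. (1 / 2) ^ (M i - q (M i))) / (2 :: real) ^ C"
          by (simp add: l_def power_add sum_divide_distrib power_one_over)
        also have "\<dots> \<le> (c + 16) / 2 ^ C"
          using sum_over_count_le[OF t(2,3) M(2) sum, of n] by (simp add: q_def divide_right_mono)
        also have "\<dots> \<le> 1" using C by simp
        finally show ?thesis .
      qed
      \<comment> \<open>The gap is \<open>q (M n) - s (M n) - C\<close>, and the half of
        \<open>q\<close> not spent on \<open>g\<close> is at least \<open>s (M n)\<close>.\<close>
      have "filterlim (\<lambda>n. - real C + real (s (M n))) at_top sequentially"
        by (rule filterlim_tendsto_add_at_top[OF tendsto_const filterlim_compose[OF s_top M(4)]])
      then show "filterlim (\<lambda>n. g (M n) - real (l n)) at_top sequentially"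
      proof (rule filterlim_at_top_mono, intro always_eventually allI)
        fix n show "- real C + real (s (M n)) \<le> g (M n) - real (l n)"
          using s_le[of "M n"] q(1)[of "M n"] unfolding g_def l_def s_def by linarith
      qed
    qed
  qed
  moreover have "COMPLEX U g \<noteq> MLR U"
    unfolding g_def
  proof (rule COMPLEX_neq_MLR[OF assms(1) rs _ s_Suc])
    show "s 0 = 0" using s_le[of 0] by simp
    \<comment> \<open>At \<open>t (4 * i)\<close> the count \<open>q\<close> exceeds
      \<open>4 * i\<close>, so its half \<open>s\<close> has reached \<open>2 * i\<close>.\<close>
    show "recursive1 (\<lambda>i. t (4 * i))"
      by (rule recursive1I, intro computable_intros computable_recursive1[OF t(1)]) auto
    show "2 * i \<le> s (t (4 * i))" for i
      using less_count_le_iff[OF t(2,3), of "4 * i" "t (4 * i)"] unfolding s_def q_def by linarith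
  qed
  ultimately show ?thesis by blast
qed

end
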